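(* Let $(K,v)$ be a non-trivially valued field. Then the group $GL_2(K)$ is generated by the matrices $$R(a)=\begin{pmatrix}a&0\\0&1\end{pmatrix}\ (a\in\mathcal{O}^\times\setminus\{1\}),\quad S=\begin{pmatrix}-1&1\\0&1\end{pmatrix},\quad J=\begin{pmatrix}0&-1\\-1&0\end{pmatrix},\quad T_\alpha=\begin{pmatrix}0&-1\\-t_\alpha&0\end{pmatrix}\ (\alpha\in\Lambda_+\setminus\{0\}),$$ subject to the following defining relations. Put $R(1)=Z(1):=1$, $Z(a):=(J R(a))^2$ for $a\in\mathcal{O}^\times\setminus\{1\}$, and for $\alpha\in\Lambda_+\setminus\{0\}$ put $Z(t_\alpha):=T_\alpha^2$, $S_\alpha:=[S,R(1-t_\alpha)]\,R(-1)$, and $J_\alpha:=J S_\alpha J$ (which represents the matrix $\begin{pmatrix}1&0\\t_\alpha&-1\end{pmatrix}$). The relations are: \begin{align*} &R(a)R(b)=R(ab),\quad Z(a)Z(b)=Z(ab),\quad [R(a),Z(b)]=1 && (a,b\in\mathcal{O}^\times\setminus\{1\}),\\ &[S,Z(a)]=1 && (a\in\mathcal{O}^\times\setminus\{1\}),\\ &S^2=1,\\ &[S,R(1-at_\alpha)]=R(a)[S,R(1-t_\alpha)]R(a)^{-1} && (\alpha\in\Lambda_+\setminus\{0\},\ a\in\mathcal{O}^\times\setminus\{1\}),\\ &S\,R(a)\,S=R(1-a)\,S\,R\Big(\frac{a}{a-1}\Big) && (a\in\mathfrak{k}),\\ &J^2=(JS)^3=1,\\ &[T_\alpha,Z(a)]=1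 && (\alpha>0,\ a\in\mathcal{O}^\times\setminus\{1\}),\\ &[T_\alpha,Z(t_\gamma)]=1 && (\alpha,\gamma>0),\\ &R(a)^{T_\alpha}=R(a)^{-1}Z(a) && (\alpha>0,\ a\in\mathcal{O}^\times\setminus\{1\}),\\ &S^{T_\alpha}=J_\alpha,\quad J_\alpha^{T_\alpha}=S && (\alpha>0),\\ &T_\alpha\,J\,T_\beta=T_{\alpha+\beta}\,R(u_{\alpha,\beta}) && (\alpha,\beta>0), \end{align*} where $u_{\alpha,\beta}=\dfrac{t_\alpha t_\beta}{t_{\alpha+\beta}}\in\mathcal{O}^\times$ for $\alpha,\beta\in\Lambda_+\setminus\{0\}$.
   Context: "Generated by ... subject to the relations" means that the abstract group with the listed generators and relations is isomorphic to the given group via the indicated assignment of generators to matrices. Conventions: $[x,y]=xyx^{-1}y^{-1}$ and $x^y=y^{-1}xy$. $(K,v)$ is a field with a non-trivial valuation, with valuation ring $\mathcal{O}\neq K$, maximal ideal $\mathfrak{m}$, residue field $k=\mathcal{O}/\mathfrak{m}$, unit group $\mathcal{O}^\times$, totally ordered abelian value group $\Lambda=v(K^\times)$ written additively, and $\Lambda_+=\{\alpha\in\Lambda:\alpha\geq0\}$; in the relations $\alpha,\beta,\gamma$ range over $\Lambda_+\setminus\{0\}$. For each $\alpha\in\Lambda_+$ an element $t_\alpha\in\mathcal{O}$ with $v(t_\alpha)=\alpha$ is fixed, with $t_0=1$. $\mathfrak{k}\subseteq\mathcal{O}^\times\setminus(1+\mathfrak{m})$ is a fixed set of representatives modulo $\mathfrak{m}$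 of the elements of $k^\times\setminus\{1\}$. *)

theory Defs
  imports "HOL-Algebra.QuotRing" "HOL-Analysis.Cartesian_Space"
begin

section \<open>Group presentations\<close>

text \<open>
  The letter \<open>(x, True)\<close> stands for the generator \<open>x\<close>, the letter \<open>(x, False)\<close> for its formal
  inverse.  The free group on \<open>X\<close> consists of the reduced words in \<open>X\<close>; the product of two words
  is the reduced form of their concatenation.
\<close>

type_synonym 'x word = "('x \<times> bool) list"

fun reduced :: "'x word \<Rightarrow> bool" where
  "reduced (p # q # w) \<longleftrightarrow> q \<noteq> (fst p, \<not> snd p) \<and> reduced (q # w)"
| "reduced _ \<longleftrightarrow> True"

definition push_letter :: "'x \<times> bool \<Rightarrow> 'x word \<Rightarrow> 'x word" where
  "push_letter p w =
     (case w of [] \<Rightarrow> [p] | q # w' \<Rightarrow> if q = (fst p, \<not> snd p) then w' else p # w)"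

definition free_group :: "'x set \<Rightarrow> 'x word monoid" where
  "free_group X =
     \<lparr>carrier = {w \<in> lists (X \<times> UNIV). reduced w}, mult = foldr push_letter, one = []\<rparr>"

definition free_gen :: "'x \<Rightarrow> 'x word" where
  "free_gen x = [(x, True)]"

definition normal_closure :: "('a, 'b) monoid_scheme \<Rightarrow> 'a set \<Rightarrow> 'a set" where
  "normal_closure G A = \<Inter>{N. N \<lhd> G \<and> A \<subseteq> N}"

text \<open>
  Relations are pairs \<open>(l, r)\<close> of elements of the free group, read as \<open>l = r\<close>.
\<close>

definition relation_subgroup :: "'x set \<Rightarrow> ('x word \<times> 'x word) set \<Rightarrow> 'x word set" where
  "relation_subgroup X Rel =
     normal_closure (free_group X)
       {l \<otimes>\<^bsub>free_group X\<^esub> inv\<^bsub>free_group X\<^esub> r | l r. (l, r) \<in> Rel}"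

definition presented_group :: "'x set \<Rightarrow> ('x word \<times> 'x word) set \<Rightarrow> 'x word set monoid" where
  "presented_group X Rel = free_group X Mod relation_subgroup X Rel"

text \<open>
  \<open>G\<close> is generated by the elements \<open>f x\<close>, \<open>x \<in> X\<close>, subject to the relations \<open>Rel\<close>.
\<close>

definition has_presentation ::
  "('a, 'b) monoid_scheme \<Rightarrow> 'x set \<Rightarrow> ('x \<Rightarrow> 'a) \<Rightarrow> ('x word \<times> 'x word) set \<Rightarrow> bool" where
  "has_presentation G X f Rel \<longleftrightarrow>
     (\<exists>\<phi> \<in> iso (presented_group X Rel) G.
        \<forall>x\<in>X. \<phi> (relation_subgroup X Rel #>\<^bsub>free_group X\<^esub> free_gen x) = f x)"

definition group_commutator :: "('a, 'b) monoid_scheme \<Rightarrow> 'a \<Rightarrow> 'a \<Rightarrow> 'a" where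
  "group_commutator G x y = x \<otimes>\<^bsub>G\<^esub> y \<otimes>\<^bsub>G\<^esub> inv\<^bsub>G\<^esub> x \<otimes>\<^bsub>G\<^esub> inv\<^bsub>G\<^esub> y"

definition group_conj :: "('a, 'b) monoid_scheme \<Rightarrow> 'a \<Rightarrow> 'a \<Rightarrow> 'a" where
  "group_conj G x y = inv\<^bsub>G\<^esub> y \<otimes>\<^bsub>G\<^esub> x \<otimes>\<^bsub>G\<^esub> y"


section \<open>Valued fields\<close>

text \<open>
  A valuation is only looked at on \<open>K\<^sup>\<times>\<close>: the value \<open>v 0\<close> is irrelevant, and \<open>v 0 = \<infinity>\<close> is built
  into the definitions below by treating \<open>0\<close> separately.  The value group is the image of \<open>K\<^sup>\<times>\<close>,
  which need not be all of the ordered group \<open>'g\<close>.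
\<close>

definition is_valuation :: "('k::field \<Rightarrow> 'g::linordered_ab_group_add) \<Rightarrow> bool" where
  "is_valuation v \<longleftrightarrow>
     (\<forall>x y. x \<noteq> 0 \<longrightarrow> y \<noteq> 0 \<longrightarrow> v (x * y) = v x + v y) \<and>
     (\<forall>x y. x \<noteq> 0 \<longrightarrow> y \<noteq> 0 \<longrightarrow> x + y \<noteq> 0 \<longrightarrow> min (v x) (v y) \<le> v (x + y))"

definition value_group :: "('k::field \<Rightarrow> 'g::linordered_ab_group_add) \<Rightarrow> 'g set" where
  "value_group v = v ` (- {0})"

definition valuation_ring :: "('k::field \<Rightarrow> 'g::linordered_ab_group_add) \<Rightarrow> 'k ring" where
  "valuation_ring v =
     \<lparr>carrier = {x. x = 0 \<or> 0 \<le> v x}, mult = (*), one = 1, zero = 0, add = (+)\<rparr>"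

definition valuation_ideal :: "('k::field \<Rightarrow> 'g::linordered_ab_group_add) \<Rightarrow> 'k set" where
  "valuation_ideal v = {x. x = 0 \<or> 0 < v x}"

definition residue_field :: "('k::field \<Rightarrow> 'g::linordered_ab_group_add) \<Rightarrow> 'k set ring" where
  "residue_field v = valuation_ring v Quot valuation_ideal v"

definition nontrivial_valuation :: "('k::field \<Rightarrow> 'g::linordered_ab_group_add) \<Rightarrow> bool" where
  "nontrivial_valuation v \<longleftrightarrow> is_valuation v \<and> carrier (valuation_ring v) \<noteq> UNIV"

definition nonneg_values :: "('k::field \<Rightarrow> 'g::linordered_ab_group_add) \<Rightarrow> 'g set" where
  "nonneg_values v = {\<alpha> \<in> value_group v. 0 \<le> \<alpha>}"

definition value_section ::
  "('k::field \<Rightarrow> 'g::linordered_ab_group_add) \<Rightarrow> ('g \<Rightarrow> 'k) \<Rightarrow> bool" where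
  "value_section v t \<longleftrightarrow>
     (\<forall>\<alpha> \<in> nonneg_values v. t \<alpha> \<noteq> 0 \<and> t \<alpha> \<in> carrier (valuation_ring v) \<and> v (t \<alpha>) = \<alpha>) \<and>
     t 0 = 1"

definition residue_representatives ::
  "('k::field \<Rightarrow> 'g::linordered_ab_group_add) \<Rightarrow> 'k set \<Rightarrow> bool" where
  "residue_representatives v \<kk> \<longleftrightarrow>
     \<kk> \<subseteq> Units (valuation_ring v) - {1 + x | x. x \<in> valuation_ideal v} \<and>
     bij_betw (\<lambda>a. valuation_ideal v +>\<^bsub>valuation_ring v\<^esub> a) \<kk>
       (Units (residue_field v) - {\<one>\<^bsub>residue_field v\<^esub>})"


section \<open>The general linear group and its generators\<close>

definition GL2 :: "('k::field ^ 2 ^ 2) monoid" where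
  "GL2 = \<lparr>carrier = {A. invertible A}, mult = (**), one = mat 1\<rparr>"

definition mat2 :: "'k::field \<Rightarrow> 'k \<Rightarrow> 'k \<Rightarrow> 'k \<Rightarrow> 'k ^ 2 ^ 2" where
  "mat2 a b c d = vector [vector [a, b], vector [c, d]]"

datatype ('k, 'g) generator = Gen_R 'k | Gen_S | Gen_J | Gen_T 'g

definition generators ::
  "('k::field \<Rightarrow> 'g::linordered_ab_group_add) \<Rightarrow> ('k, 'g) generator set" where
  "generators v =
     Gen_R ` (Units (valuation_ring v) - {1}) \<union> {Gen_S, Gen_J} \<union> Gen_T ` (nonneg_values v - {0})"

fun gen_matrix :: "('g \<Rightarrow> 'k::field) \<Rightarrow> ('k, 'g) generator \<Rightarrow> 'k ^ 2 ^ 2" where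
  "gen_matrix t (Gen_R a) = mat2 a 0 0 1"
| "gen_matrix t Gen_S = mat2 (-1) 1 0 1"
| "gen_matrix t Gen_J = mat2 0 (-1) (-1) 0"
| "gen_matrix t (Gen_T \<alpha>) = mat2 0 (-1) (- t \<alpha>) 0"


section \<open>The defining relations\<close>

text \<open>
  The words occurring in the relations make sense in any group \<open>G\<close> with a distinguished family
  \<open>g\<close> of elements indexed by the generators.
\<close>

context
  fixes G :: "('a, 'b) monoid_scheme" (structure)
    and g :: "('k::field, 'g::linordered_ab_group_add) generator \<Rightarrow> 'a"
    and t :: "'g \<Rightarrow> 'k"
begin

definition R_elt :: "'k \<Rightarrow> 'a" where
  "R_elt a = (if a = 1 then \<one> else g (Gen_R a))"

definition S_elt :: 'a where
  "S_elt = g Gen_S"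

definition J_elt :: 'a where
  "J_elt = g Gen_J"

definition T_elt :: "'g \<Rightarrow> 'a" where
  "T_elt \<alpha> = g (Gen_T \<alpha>)"

text \<open>
  The notation \<open>Z(a)\<close> for units \<open>a\<close> and \<open>Z(t\<^sub>\<alpha>)\<close> for \<open>\<alpha> > 0\<close> is split into two functions.
\<close>

definition Z_elt :: "'k \<Rightarrow> 'a" where
  "Z_elt a = (if a = 1 then \<one> else (J_elt \<otimes> R_elt a) [^] (2::nat))"

definition Zt_elt :: "'g \<Rightarrow> 'a" where
  "Zt_elt \<alpha> = T_elt \<alpha> [^] (2::nat)"

definition S\<alpha>_elt :: "'g \<Rightarrow> 'a" where
  "S\<alpha>_elt \<alpha> = group_commutator G S_elt (R_elt (1 - t \<alpha>)) \<otimes> R_elt (-1)"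

definition J\<alpha>_elt :: "'g \<Rightarrow> 'a" where
  "J\<alpha>_elt \<alpha> = J_elt \<otimes> S\<alpha>_elt \<alpha> \<otimes> J_elt"

definition GL2_relations :: "('k \<Rightarrow> 'g) \<Rightarrow> 'k set \<Rightarrow> ('a \<times> 'a) set" where
  "GL2_relations v \<kk> =
     (let U = Units (valuation_ring v) - {1}; P = nonneg_values v - {0} in
      {(R_elt a \<otimes> R_elt b, R_elt (a * b)) | a b. a \<in> U \<and> b \<in> U} \<union>
      {(Z_elt a \<otimes> Z_elt b, Z_elt (a * b)) | a b. a \<in> U \<and> b \<in> U} \<union>
      {(group_commutator G (R_elt a) (Z_elt b), \<one>) | a b. a \<in> U \<and> b \<in> U} \<union>
      {(group_commutator G S_elt (Z_elt a), \<one>) | a. a \<in> U} \<union>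
      {(S_elt [^] (2::nat), \<one>)} \<union>
      {(group_commutator G S_elt (R_elt (1 - a * t \<alpha>)),
        R_elt a \<otimes> group_commutator G S_elt (R_elt (1 - t \<alpha>)) \<otimes> inv (R_elt a)) | \<alpha> a.
          \<alpha> \<in> P \<and> a \<in> U} \<union>
      {(S_elt \<otimes> R_elt a \<otimes> S_elt, R_elt (1 - a) \<otimes> S_elt \<otimes> R_elt (a / (a - 1))) | a. a \<in> \<kk>} \<union>
      {(J_elt [^] (2::nat), \<one>), ((J_elt \<otimes> S_elt) [^] (3::nat), \<one>)} \<union>
      {(group_commutator G (T_elt \<alpha>) (Z_elt a), \<one>) | \<alpha> a. \<alpha> \<in> P \<and> a \<in> U} \<union>
      {(group_commutator G (T_elt \<alpha>) (Zt_elt \<gamma>), \<one>) | \<alpha> \<gamma>. \<alpha> \<in> P \<and> \<gamma> \<in> P} \<union>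
      {(group_conj G (R_elt a) (T_elt \<alpha>), inv (R_elt a) \<otimes> Z_elt a) | \<alpha> a. \<alpha> \<in> P \<and> a \<in> U} \<union>
      {(group_conj G S_elt (T_elt \<alpha>), J\<alpha>_elt \<alpha>) | \<alpha>. \<alpha> \<in> P} \<union>
      {(group_conj G (J\<alpha>_elt \<alpha>) (T_elt \<alpha>), S_elt) | \<alpha>. \<alpha> \<in> P} \<union>
      {(T_elt \<alpha> \<otimes> J_elt \<otimes> T_elt \<beta>, T_elt (\<alpha> + \<beta>) \<otimes> R_elt (t \<alpha> * t \<beta> / t (\<alpha> + \<beta>))) | \<alpha> \<beta>.
          \<alpha> \<in> P \<and> \<beta> \<in> P})"

end

end

theory Submission
  imports Defs
begin

text \<open>
  In any group satisfying the relations, \<open>J T\<^sub>\<alpha>\<close> plays the role of \<open>diag(t\<^sub>\<alpha>, 1)\<close>.  The products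
  \<open>R(a) J T\<^sub>\<alpha>\<close> are multiplicative in \<open>a t\<^sub>\<alpha>\<close>, hence extend to a homomorphism \<open>RK\<close> on \<open>K\<^sup>\<times>\<close>, and the
  elements \<open>ZK(x) = (J RK(x))\<^sup>2\<close> are central.  The conjugates \<open>E(x) = RK(x) S R(-1) RK(x)\<^sup>-\<^sup>1\<close> are the
  commutators \<open>[S, R(1 - x)]\<close> for \<open>x\<close> in the maximal ideal, where they are additive in \<open>x\<close>; by
  scaling they are additive on all of \<open>K\<close>.  Hence the elements \<open>ZK(z) RK(y) E(x)\<close> form a subgroup
  \<open>B\<close>, and \<open>(J S)\<^sup>3 = 1\<close> puts \<open>J E(x) J\<close> into \<open>B J B\<close> for \<open>x \<noteq> 0\<close>.  So every element lies in
  \<open>B\<close> or in \<open>B J E(K)\<close>, and the matrix of such a normal form determines it.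
\<close>

section \<open>Free groups and presentations\<close>

lemma push_letter_reduced: "reduced w \<Longrightarrow> reduced (push_letter p w)"
  by (cases w rule: reduced.cases) (auto simp: push_letter_def)

lemma push_letter_words: "w \<in> lists (X \<times> UNIV) \<Longrightarrow> fst p \<in> X \<Longrightarrow> push_letter p w \<in> lists (X \<times> UNIV)"
  by (cases p) (auto simp: push_letter_def split: list.splits)

text \<open>If the first push cancels the head of \<open>w\<close>, the second one restores it:
  reducedness prevents the next letter of \<open>w\<close> from cancelling in turn.\<close>

lemma push_letter_cancel:
  assumes "reduced w"
  shows "push_letter (x, \<not> b) (push_letter (x, b) w) = w"
  using assms by (cases w rule: reduced.cases) (auto simp: push_letter_def split: list.splits)

lemma push_letter_Cons_reduced: "reduced (p # w) \<Longrightarrow> push_letter p w = p # w"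
  by (cases w) (auto simp: push_letter_def)

lemma reduced_Cons_D: "reduced (p # w) \<Longrightarrow> reduced w"
  by (cases w) auto

lemma foldr_push_reduced: "reduced w \<Longrightarrow> reduced (foldr push_letter u w)"
  by (induction u) (auto intro: push_letter_reduced)

lemma foldr_push_words:
  "u \<in> lists (X \<times> UNIV) \<Longrightarrow> w \<in> lists (X \<times> UNIV) \<Longrightarrow> foldr push_letter u w \<in> lists (X \<times> UNIV)"
  by (induction u) (auto simp: mem_Times_iff push_letter_words simp del: in_lists_conv_set)

lemma foldr_push_Nil: "reduced u \<Longrightarrow> foldr push_letter u [] = u"
proof (induction u)
  case (Cons p u)
  then have "foldr push_letter u [] = u" by (blast dest: reduced_Cons_D)
  then show ?case using Cons.prems by (simp add: push_letter_Cons_reduced)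
qed simp

text \<open>Mutually inverse letters act on reduced words as inverse maps, so a cancellation between
  \<open>p\<close> and the head of \<open>u\<close> leaves the action unchanged. Associativity then
  follows without comparing reductions of a triple product.\<close>

lemma foldr_push_push_letter:
  assumes "reduced w"
  shows "foldr push_letter (push_letter p u) w = push_letter p (foldr push_letter u w)"
proof (cases u)
  case (Cons q u')
  show ?thesis
  proof (cases "q = (fst p, \<not> snd p)")
    case True
    have "push_letter p (push_letter q (foldr push_letter u' w)) = foldr push_letter u' w"
      using push_letter_cancel[OF foldr_push_reduced[OF assms], of "fst p" "\<not> snd p" u'] True by simp
    then show ?thesis
      using Cons True by (simp add: push_letter_def)
  qed (use Cons in \<open>simp add: push_letter_def\<close>)
qed (simp add: push_letter_def)

lemma foldr_push_assoc:
  "reduced w \<Longrightarrow> foldr push_letter (foldr push_letter u v) w = foldr push_letter u (foldr push_letter v w)"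
  by (induction u) (auto simp: foldr_push_push_letter)

definition inverse_word :: "'x word \<Rightarrow> 'x word" where
  "inverse_word u = rev (map (\<lambda>p. (fst p, \<not> snd p)) u)"

lemma foldr_push_inverse_word:
  "reduced w \<Longrightarrow> foldr push_letter (inverse_word u) (foldr push_letter u w) = w"
proof (induction u arbitrary: w)
  case (Cons p u)
  have "push_letter (fst p, \<not> snd p) (push_letter p (foldr push_letter u w)) = foldr push_letter u w"
    using push_letter_cancel[OF foldr_push_reduced[OF Cons.prems], of "fst p" "snd p" u] by simp
  then show ?case
    using Cons by (simp add: inverse_word_def)
qed (simp add: inverse_word_def)

lemma inverse_word_words: "u \<in> lists (X \<times> UNIV) \<Longrightarrow> inverse_word u \<in> lists (X \<times> UNIV)"
  by (fastforce simp: inverse_word_def)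

lemma group_free_group: "group (free_group X)"
proof (rule groupI)
  fix u assume u: "u \<in> carrier (free_group X)"
  \<comment> \<open>Pushing the letters onto \<open>[]\<close> reduces the inverse word, so its
    reducedness needs no separate argument.\<close>
  let ?v = "foldr push_letter (inverse_word u) []"
  have "?v \<in> carrier (free_group X)"
    using u by (simp add: free_group_def foldr_push_reduced foldr_push_words inverse_word_words del: in_lists_conv_set)
  moreover have "foldr push_letter ?v u = []"
    using u foldr_push_inverse_word[of "[]" u]
    by (simp add: foldr_push_assoc free_group_def foldr_push_Nil)
  ultimately show "\<exists>v\<in>carrier (free_group X). v \<otimes>\<^bsub>free_group X\<^esub> u = \<one>\<^bsub>free_group X\<^esub>"
    by (auto simp: free_group_def)
qed (simp_all add: free_group_def foldr_push_reduced foldr_push_words foldr_push_assoc del: in_lists_conv_set)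

lemma free_gen_closed: "x \<in> X \<Longrightarrow> free_gen x \<in> carrier (free_group X)"
  by (simp add: free_gen_def free_group_def)

lemma inv_free_gen:
  assumes "x \<in> X"
  shows "inv\<^bsub>free_group X\<^esub> free_gen x = [(x, False)]"
proof -
  interpret group "free_group X" by (rule group_free_group)
  have "[(x, False)] \<otimes>\<^bsub>free_group X\<^esub> free_gen x = \<one>\<^bsub>free_group X\<^esub>"
    by (simp add: free_group_def free_gen_def push_letter_def)
  moreover have "[(x, False)] \<in> carrier (free_group X)"
    using assms by (simp add: free_group_def)
  ultimately show ?thesis
    using inv_equality[of "[(x, False)]" "free_gen x"] free_gen_closed[OF assms] by simp
qed

text \<open>A reduced word stays reduced when its first letter is removed, and putting the letter
  back is a product without cancellation; hence list induction suffices.\<close>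

lemma free_group_induct [consumes 1, case_names one gen inv_gen]:
  assumes "w \<in> carrier (free_group X)"
    and "P \<one>\<^bsub>free_group X\<^esub>"
    and "\<And>x w. x \<in> X \<Longrightarrow> w \<in> carrier (free_group X) \<Longrightarrow> P w \<Longrightarrow>
      P (free_gen x \<otimes>\<^bsub>free_group X\<^esub> w)"
    and "\<And>x w. x \<in> X \<Longrightarrow> w \<in> carrier (free_group X) \<Longrightarrow> P w \<Longrightarrow>
      P (inv\<^bsub>free_group X\<^esub> free_gen x \<otimes>\<^bsub>free_group X\<^esub> w)"
  shows "P w"
  using assms(1)
proof (induction w)
  case Nil
  then show ?case using assms(2) by (simp add: free_group_def)
next
  case (Cons p w)
  have w: "w \<in> carrier (free_group X)"
    using Cons.prems by (auto simp: free_group_def dest: reduced_Cons_D)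
  obtain x b where p: "p = (x, b)" by (cases p)
  have x: "x \<in> X" using Cons.prems p by (simp add: free_group_def)
  have eq: "[p] \<otimes>\<^bsub>free_group X\<^esub> w = p # w"
    using Cons.prems by (simp add: free_group_def push_letter_Cons_reduced)
  show ?case
    using assms(3,4)[OF x w Cons.IH[OF w]] eq p inv_free_gen[OF x]
    by (cases b) (auto simp: free_gen_def)
qed

section \<open>Homomorphisms out of the free group\<close>

definition eval_word :: "('a, 'b) monoid_scheme \<Rightarrow> ('x \<Rightarrow> 'a) \<Rightarrow> 'x word \<Rightarrow> 'a" where
  "eval_word H f w =
     foldr (\<lambda>p y. (if snd p then f (fst p) else inv\<^bsub>H\<^esub> f (fst p)) \<otimes>\<^bsub>H\<^esub> y) w \<one>\<^bsub>H\<^esub>"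

context group begin

lemma eval_word_closed:
  "f ` X \<subseteq> carrier G \<Longrightarrow> w \<in> lists (X \<times> UNIV) \<Longrightarrow> eval_word G f w \<in> carrier G"
  by (induction w) (auto simp: eval_word_def)

text \<open>A cancelled pair of letters evaluates to an element times its inverse, so evaluation
  does not see reduction.\<close>

lemma eval_word_push_letter:
  assumes f: "f ` X \<subseteq> carrier G" and "fst p \<in> X" and "w \<in> lists (X \<times> UNIV)"
  shows "eval_word G f (push_letter p w) =
    (if snd p then f (fst p) else inv f (fst p)) \<otimes> eval_word G f w"
proof (cases w)
  case (Cons q w')
  have "fst q \<in> X" "w' \<in> lists (X \<times> UNIV)" using assms Cons by auto
  then show ?thesis
    using assms Cons eval_word_closed[OF f, of w']
    by (auto simp: push_letter_def eval_word_def m_assoc[symmetric] image_subset_iff split: if_splits)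
qed (simp add: push_letter_def eval_word_def)

lemma eval_word_hom:
  assumes f: "f ` X \<subseteq> carrier G"
  shows "eval_word G f \<in> hom (free_group X) G"
proof (rule homI)
  fix u w assume u: "u \<in> carrier (free_group X)" and w: "w \<in> carrier (free_group X)"
  have wX: "w \<in> lists (X \<times> UNIV)" using w by (simp add: free_group_def)
  have "u \<in> lists (X \<times> UNIV)" using u by (simp add: free_group_def)
  then have "eval_word G f (foldr push_letter u w) = eval_word G f u \<otimes> eval_word G f w"
  proof (induction u rule: list.induct)
    case Nil
    then show ?case using eval_word_closed[OF f wX] by (simp add: eval_word_def)
  next
    case (Cons p u)
    have p: "fst p \<in> X" and u: "u \<in> lists (X \<times> UNIV)"
      using Cons.prems by (auto simp: mem_Times_iff)
    have "eval_word G f (foldr push_letter (p # u) w) =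
      (if snd p then f (fst p) else inv f (fst p)) \<otimes> eval_word G f (foldr push_letter u w)"
      using eval_word_push_letter[OF f p foldr_push_words[OF u wX]] by simp
    also have "\<dots> = eval_word G f (p # u) \<otimes> eval_word G f w"
      using p f eval_word_closed[OF f u] eval_word_closed[OF f wX] Cons.IH[OF u]
      by (auto simp: eval_word_def m_assoc image_subset_iff)
    finally show ?case .
  qed
  then show "eval_word G f (u \<otimes>\<^bsub>free_group X\<^esub> w) = eval_word G f u \<otimes> eval_word G f w"
    by (simp add: free_group_def)
qed (simp add: free_group_def eval_word_closed[OF f])

lemma eval_word_free_gen: "f x \<in> carrier G \<Longrightarrow> eval_word G f (free_gen x) = f x"
  by (simp add: eval_word_def free_gen_def)

section \<open>Normal closures and a criterion for presentations\<close>

lemma normal_closure_least: "N \<lhd> G \<Longrightarrow> A \<subseteq> N \<Longrightarrow> normal_closure G A \<subseteq> N"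
  by (auto simp: normal_closure_def)

lemma subset_normal_closure: "A \<subseteq> normal_closure G A"
  by (auto simp: normal_closure_def)

lemma normal_closure_normal:
  assumes "A \<subseteq> carrier G"
  shows "normal_closure G A \<lhd> G"
proof -
  let ?S = "{N. N \<lhd> G \<and> A \<subseteq> N}"
  \<comment> \<open>The carrier belongs to the family, so the intersection is not over an empty
    family.\<close>
  have "carrier G \<lhd> G" by (simp add: normal_inv_iff subgroup_self)
  then have ne: "?S \<noteq> {}" using assms by auto
  have "subgroup (\<Inter>?S) G"
    using ne by (intro subgroups_Inter) (auto simp: normal_imp_subgroup)
  then show ?thesis
    unfolding normal_closure_def normal_inv_iff by (auto simp: normal_inv_iff)
qed

end

text \<open>Evaluation of words kills the relators and so induces the map on the quotient. The
  premise \<open>bij\<close> hides the coset construction: it concerns any homomorphism with the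
  right values on generators, with the relations available as equations of cosets.\<close>

lemma has_presentationI:
  assumes "group H"
    and f: "f ` X \<subseteq> carrier H"
    and Rel: "\<And>l r. (l, r) \<in> Rel \<Longrightarrow> l \<in> carrier (free_group X) \<and> r \<in> carrier (free_group X)"
    and eq: "\<And>h l r. h \<in> hom (free_group X) H \<Longrightarrow> (\<And>x. x \<in> X \<Longrightarrow> h (free_gen x) = f x) \<Longrightarrow>
      (l, r) \<in> Rel \<Longrightarrow> h l = h r"
    and bij: "\<And>\<phi>. group (presented_group X Rel) \<Longrightarrow>
      (\<lambda>w. relation_subgroup X Rel #>\<^bsub>free_group X\<^esub> w) \<in> hom (free_group X) (presented_group X Rel) \<Longrightarrow>
      (\<And>l r. (l, r) \<in> Rel \<Longrightarrow>
        relation_subgroup X Rel #>\<^bsub>free_group X\<^esub> l = relation_subgroup X Rel #>\<^bsub>free_group X\<^esub> r) \<Longrightarrow>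
      \<phi> \<in> hom (presented_group X Rel) H \<Longrightarrow>
      (\<And>x. x \<in> X \<Longrightarrow> \<phi> (relation_subgroup X Rel #>\<^bsub>free_group X\<^esub> free_gen x) = f x) \<Longrightarrow>
      bij_betw \<phi> (carrier (presented_group X Rel)) (carrier H)"
  shows "has_presentation H X f Rel"
proof -
  interpret F: group "free_group X" by (rule group_free_group)
  interpret H: group H by fact
  let ?F = "free_group X" and ?N = "relation_subgroup X Rel"
  define A where "A = {l \<otimes>\<^bsub>?F\<^esub> inv\<^bsub>?F\<^esub> r | l r. (l, r) \<in> Rel}"
  have A: "A \<subseteq> carrier ?F" using Rel by (auto simp: A_def)
  have N_def: "?N = normal_closure ?F A" by (simp add: relation_subgroup_def A_def)
  have N: "?N \<lhd> ?F" unfolding N_def by (rule F.normal_closure_normal[OF A])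
  interpret N: normal ?N ?F by (rule N)
  let ?h = "eval_word H f"
  have h: "?h \<in> hom ?F H" by (rule H.eval_word_hom[OF f])
  interpret h: group_hom ?F H ?h by unfold_locales (rule h)
  have hf: "?h (free_gen x) = f x" if "x \<in> X" for x
    using that f by (intro H.eval_word_free_gen) auto
  have "A \<subseteq> kernel ?F H ?h"
    using eq[OF h hf] Rel by (fastforce simp: A_def kernel_def)
  then have "?N \<subseteq> kernel ?F H ?h"
    unfolding N_def by (intro F.normal_closure_least h.normal_kernel)
  then obtain \<phi> where \<phi>: "\<phi> \<in> hom (?F Mod ?N) H"
    "\<And>x. x \<in> carrier ?F \<Longrightarrow> \<phi> (?N #>\<^bsub>?F\<^esub> x) = ?h x"
    using h.FactGroup_universal_kernel[OF N] by blast
  have \<phi>f: "\<phi> (?N #>\<^bsub>?F\<^esub> free_gen x) = f x" if "x \<in> X" for x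
    using \<phi>(2)[OF free_gen_closed[OF that]] hf[OF that] by simp
  have rel: "?N #>\<^bsub>?F\<^esub> l = ?N #>\<^bsub>?F\<^esub> r" if "(l, r) \<in> Rel" for l r
  proof -
    have "l \<otimes>\<^bsub>?F\<^esub> inv\<^bsub>?F\<^esub> r \<in> ?N"
      using F.subset_normal_closure[of A] that by (auto simp: N_def A_def)
    then have "l \<in> ?N #>\<^bsub>?F\<^esub> r"
      using Rel[OF that] N.rcos_module[OF F.is_group] by blast
    then show ?thesis
      using F.repr_independence Rel[OF that] N.is_subgroup by metis
  qed
  have "bij_betw \<phi> (carrier (presented_group X Rel)) (carrier H)"
    using N.factorgroup_is_group N.r_coset_hom_Mod rel \<phi>(1) \<phi>f
    by (intro bij) (auto simp: presented_group_def)
  then show ?thesis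
    using \<phi>(1) \<phi>f by (auto simp: has_presentation_def iso_def presented_group_def)
qed

section \<open>Computing in groups\<close>

text \<open>Clears inverses, which turns the relations into equations between products that serve as
  rewrite rules.\<close>

lemma (in group) commutator_eq_iff:
  assumes "x \<in> carrier G" "y \<in> carrier G" "z \<in> carrier G"
  shows "group_commutator G x y = z \<longleftrightarrow> x \<otimes> y = z \<otimes> (y \<otimes> x)"
proof -
  have "group_commutator G x y = (x \<otimes> y) \<otimes> inv (y \<otimes> x)"
    using assms by (simp add: group_commutator_def inv_mult_group m_assoc)
  then show ?thesis
    using assms by (simp add: inv_solve_right')
qed

lemma (in group) commutator_eq_one_iff:
  "x \<in> carrier G \<Longrightarrow> y \<in> carrier G \<Longrightarrow> group_commutator G x y = \<one> \<longleftrightarrow> x \<otimes> y = y \<otimes> x"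
  by (simp add: commutator_eq_iff)

lemma (in group) conj_eq_iff:
  assumes "x \<in> carrier G" "y \<in> carrier G" "z \<in> carrier G"
  shows "group_conj G x y = z \<longleftrightarrow> x \<otimes> y = y \<otimes> z"
  using assms by (simp add: group_conj_def m_assoc inv_solve_left')

text \<open>In a right-associated product an equation for \<open>x \<otimes> y\<close> matches only
  at the end; this form applies it in front of further factors.\<close>

lemma (in monoid) lift_eq:
  assumes "x \<otimes> y = z" "x \<in> carrier G" "y \<in> carrier G" "w \<in> carrier G"
  shows "x \<otimes> (y \<otimes> w) = z \<otimes> w"
  using assms by (metis m_assoc)

lemma (in monoid) square_eq: "x \<in> carrier G \<Longrightarrow> x [^] (2::nat) = x \<otimes> x"
  by (simp add: numeral_2_eq_2)

lemma (in monoid) commute_mult: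
  assumes "z \<otimes> x = x \<otimes> z" "z \<otimes> y = y \<otimes> z" "x \<in> carrier G" "y \<in> carrier G" "z \<in> carrier G"
  shows "z \<otimes> (x \<otimes> y) = x \<otimes> y \<otimes> z"
  using assms by (metis m_assoc)

lemma (in group) commute_inv:
  assumes "z \<otimes> x = x \<otimes> z" "x \<in> carrier G" "z \<in> carrier G"
  shows "z \<otimes> inv x = inv x \<otimes> z"
  using assms by (metis inv_closed inv_solve_left inv_solve_right m_assoc m_closed)

section \<open>Valued fields with a section of the valuation\<close>

locale valued_field =
  fixes v :: "'k::field \<Rightarrow> 'g::linordered_ab_group_add" and t :: "'g \<Rightarrow> 'k"
  assumes valuation: "nontrivial_valuation v" and sect: "value_section v t"
begin

lemma v_mult [simp]: "x \<noteq> 0 \<Longrightarrow> y \<noteq> 0 \<Longrightarrow> v (x * y) = v x + v y"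
  using valuation by (simp add: nontrivial_valuation_def is_valuation_def)

lemma v_add: "x \<noteq> 0 \<Longrightarrow> y \<noteq> 0 \<Longrightarrow> x + y \<noteq> 0 \<Longrightarrow> min (v x) (v y) \<le> v (x + y)"
  using valuation by (simp add: nontrivial_valuation_def is_valuation_def)

lemma v_one [simp]: "v 1 = 0"
  using v_mult[of 1 1] by simp

lemma v_minus [simp]: "v (- x) = v x"
proof (cases "x = 0")
  case False
  have "v (-1) + v (-1) = 0" using v_mult[of "-1" "-1"] by simp
  \<comment> \<open>An ordered abelian group has no 2-torsion.\<close>
  then have "v (-1) = 0" by simp
  then show ?thesis using v_mult[of "-1" x] False by simp
qed simp

lemma v_inverse [simp]: "x \<noteq> 0 \<Longrightarrow> v (inverse x) = - v x"
  using v_mult[of x "inverse x"] by (simp add: eq_neg_iff_add_eq_0 add.commute)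

lemma v_divide [simp]: "x \<noteq> 0 \<Longrightarrow> y \<noteq> 0 \<Longrightarrow> v (x / y) = v x - v y"
  by (simp add: divide_inverse)

text \<open>The ultrametric inequality for \<open>1 - x\<close> gives a value of at least 0; applied
  to \<open>1 = (1 - x) + x\<close> it excludes a positive value, since
  \<open>v 1 = 0\<close>.\<close>

lemma one_minus_unit:
  assumes "x = 0 \<or> 0 < v x"
  shows "1 - x \<noteq> 0" and "v (1 - x) = 0"
proof -
  show ne: "1 - x \<noteq> 0" using assms by auto
  show "v (1 - x) = 0"
  proof (cases "x = 0")
    case False
    then have "min (v 1) (v (-x)) \<le> v (1 - x)" using v_add[of 1 "-x"] ne by simp
    then have "0 \<le> v (1 - x)" using assms False by auto
    moreover have "min (v (1 - x)) (v x) \<le> v 1" using v_add[of "1 - x" x] ne False by simp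
    ultimately show ?thesis using assms False by (auto simp: min_def split: if_splits)
  qed simp
qed

definition unit :: "'k \<Rightarrow> bool" where "unit x \<longleftrightarrow> x \<noteq> 0 \<and> v x = 0"

lemma Units_iff: "x \<in> Units (valuation_ring v) \<longleftrightarrow> unit x"
proof
  assume "x \<in> Units (valuation_ring v)"
  then obtain y where xy: "x = 0 \<or> 0 \<le> v x" "y = 0 \<or> 0 \<le> v y" "y * x = 1"
    by (auto simp: Units_def valuation_ring_def)
  then have "x \<noteq> 0" "y \<noteq> 0" by auto
  moreover from this have "v y + v x = 0" using xy(3) v_mult[of y x] by simp
  ultimately show "unit x" using xy by (auto simp: unit_def add_nonneg_eq_0_iff)
next
  assume "unit x"
  then show "x \<in> Units (valuation_ring v)"
    by (auto simp: Units_def valuation_ring_def unit_def intro!: exI[of _ "inverse x"])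
qed

lemma unit_simps [simp]:
  "unit 1" "unit x \<Longrightarrow> unit y \<Longrightarrow> unit (x * y)" "unit x \<Longrightarrow> unit y \<Longrightarrow> unit (x / y)"
  "unit x \<Longrightarrow> unit (inverse x)" "unit (- x) \<longleftrightarrow> unit x"
  by (auto simp: unit_def)

lemma unit_nonzero: "unit x \<Longrightarrow> x \<noteq> 0"
  by (simp add: unit_def)

lemma t_simps [simp]:
  assumes "\<alpha> \<in> nonneg_values v"
  shows "t \<alpha> \<noteq> 0" "v (t \<alpha>) = \<alpha>" "0 \<le> \<alpha>"
  using sect assms by (auto simp: value_section_def nonneg_values_def)

lemma t_zero [simp]: "t 0 = 1"
  using sect by (simp add: value_section_def)

lemma nonneg_valuesI: "x \<noteq> 0 \<Longrightarrow> 0 \<le> v x \<Longrightarrow> v x \<in> nonneg_values v"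
  unfolding nonneg_values_def value_group_def by (intro CollectI conjI imageI) auto

lemma nonneg_values_zero [simp]: "0 \<in> nonneg_values v"
  using nonneg_valuesI[of 1] by simp

lemma nonneg_values_add [simp]:
  assumes "\<alpha> \<in> nonneg_values v" "\<beta> \<in> nonneg_values v"
  shows "\<alpha> + \<beta> \<in> nonneg_values v"
  using nonneg_valuesI[of "t \<alpha> * t \<beta>"] assms by simp

lemma unit_u: "\<alpha> \<in> nonneg_values v \<Longrightarrow> \<beta> \<in> nonneg_values v \<Longrightarrow> unit (t \<alpha> * t \<beta> / t (\<alpha> + \<beta>))"
  by (simp add: unit_def)

lemma unit_one_minus_t [simp]:
  assumes "\<alpha> \<in> nonneg_values v" "\<alpha> \<noteq> 0"
  shows "unit (1 - t \<alpha>)" "unit a \<Longrightarrow> unit (1 - a * t \<alpha>)"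
proof -
  have "0 < \<alpha>" using t_simps(3)[OF assms(1)] assms(2) by simp
  then show "unit (1 - t \<alpha>)" "unit a \<Longrightarrow> unit (1 - a * t \<alpha>)"
    using one_minus_unit[of "t \<alpha>"] one_minus_unit[of "a * t \<alpha>"] assms(1)
    by (auto simp: unit_def)
qed

text \<open>Nontriviality of the valuation enters here: an element outside the valuation ring has an
  inverse of positive value. Such elements later scale arbitrary elements into the maximal
  ideal.\<close>

lemma positive_element: obtains \<pi> where "\<pi> \<noteq> 0" "0 < v \<pi>"
proof -
  have "\<exists>x. \<not> (x = 0 \<or> 0 \<le> v x)"
    using valuation by (auto simp: nontrivial_valuation_def valuation_ring_def)
  then obtain x where "x \<noteq> 0" "v x < 0" by (auto simp: not_le)
  then show ?thesis using that[of "inverse x"] by simp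
qed

text \<open>The element \<open>a - 1\<close> lies in the valuation ring but not in the maximal
  ideal, so it is a unit. Hence the relation for \<open>S R(a) S\<close> involves \<open>R\<close>
  at units only.\<close>

lemma representatives_units:
  assumes "residue_representatives v \<kk>" "a \<in> \<kk>"
  shows "unit a" "unit (1 - a)" "a \<noteq> 1"
proof -
  have a: "a \<in> Units (valuation_ring v)" and nm: "\<And>x. x \<in> valuation_ideal v \<Longrightarrow> a \<noteq> 1 + x"
    using assms by (auto simp: residue_representatives_def)
  show u: "unit a" using a by (simp add: Units_iff)
  have ne: "a - 1 \<noteq> 0" and nv: "\<not> 0 < v (a - 1)"
    using nm[of "a - 1"] by (auto simp: valuation_ideal_def)
  then show "a \<noteq> 1" by simp
  have "min (v a) (v (-1)) \<le> v (a - 1)"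
    using v_add[of a "-1"] u ne by (simp add: unit_def)
  then have "v (a - 1) = 0" using u nv by (auto simp: unit_def)
  then show "unit (1 - a)" using ne v_minus[of "a - 1"] by (auto simp: unit_def)
qed

definition pos :: "'g \<Rightarrow> bool" where "pos \<alpha> \<longleftrightarrow> \<alpha> \<in> nonneg_values v \<and> \<alpha> \<noteq> 0"

lemma posD [simp, dest]: "pos \<alpha> \<Longrightarrow> \<alpha> \<in> nonneg_values v" "pos \<alpha> \<Longrightarrow> \<alpha> \<noteq> 0"
  by (auto simp: pos_def)

lemma pos_add: "pos \<alpha> \<Longrightarrow> pos \<beta> \<Longrightarrow> pos (\<alpha> + \<beta>)"
  using t_simps(3)[of \<alpha>] t_simps(3)[of \<beta>]
  by (simp add: pos_def add_nonneg_eq_0_iff del: posD)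

lemma ball_pairs1: "(\<forall>p\<in>{(l a, r a) |a. P a}. Q p) \<longleftrightarrow> (\<forall>a. P a \<longrightarrow> Q (l a, r a))"
  by blast

lemma ball_pairs2: "(\<forall>p\<in>{(l a b, r a b) |a b. P a b}. Q p) \<longleftrightarrow> (\<forall>a b. P a b \<longrightarrow> Q (l a b, r a b))"
  by blast

text \<open>Spells out the set of relations once, for an arbitrary predicate. It serves to extract
  the relations, to verify them for matrices, and to transport them along homomorphisms.\<close>

lemma ball_GL2_relations:
  fixes G :: "('a, 'b) monoid_scheme" (structure)
  shows "(\<forall>p\<in>GL2_relations G g t v \<kk>. Q p) \<longleftrightarrow>
   (\<forall>a b. unit a \<and> a \<noteq> 1 \<and> unit b \<and> b \<noteq> 1 \<longrightarrow>
      Q (R_elt G g a \<otimes> R_elt G g b, R_elt G g (a * b))) \<and>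
   (\<forall>a b. unit a \<and> a \<noteq> 1 \<and> unit b \<and> b \<noteq> 1 \<longrightarrow>
      Q (Z_elt G g a \<otimes> Z_elt G g b, Z_elt G g (a * b))) \<and>
   (\<forall>a b. unit a \<and> a \<noteq> 1 \<and> unit b \<and> b \<noteq> 1 \<longrightarrow>
      Q (group_commutator G (R_elt G g a) (Z_elt G g b), \<one>)) \<and>
   (\<forall>a. unit a \<and> a \<noteq> 1 \<longrightarrow> Q (group_commutator G (S_elt g) (Z_elt G g a), \<one>)) \<and>
   Q (S_elt g [^] (2::nat), \<one>) \<and>
   (\<forall>\<alpha> a. pos \<alpha> \<and> unit a \<and> a \<noteq> 1 \<longrightarrow>
      Q (group_commutator G (S_elt g) (R_elt G g (1 - a * t \<alpha>)),
         R_elt G g a \<otimes> group_commutator G (S_elt g) (R_elt G g (1 - t \<alpha>)) \<otimes> inv R_elt G g a)) \<and>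
   (\<forall>a. a \<in> \<kk> \<longrightarrow> Q (S_elt g \<otimes> R_elt G g a \<otimes> S_elt g,
      R_elt G g (1 - a) \<otimes> S_elt g \<otimes> R_elt G g (a / (a - 1)))) \<and>
   Q (J_elt g [^] (2::nat), \<one>) \<and> Q ((J_elt g \<otimes> S_elt g) [^] (3::nat), \<one>) \<and>
   (\<forall>\<alpha> a. pos \<alpha> \<and> unit a \<and> a \<noteq> 1 \<longrightarrow> Q (group_commutator G (T_elt g \<alpha>) (Z_elt G g a), \<one>)) \<and>
   (\<forall>\<alpha> \<gamma>. pos \<alpha> \<and> pos \<gamma> \<longrightarrow> Q (group_commutator G (T_elt g \<alpha>) (Zt_elt G g \<gamma>), \<one>)) \<and>
   (\<forall>\<alpha> a. pos \<alpha> \<and> unit a \<and> a \<noteq> 1 \<longrightarrow>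
      Q (group_conj G (R_elt G g a) (T_elt g \<alpha>), inv R_elt G g a \<otimes> Z_elt G g a)) \<and>
   (\<forall>\<alpha>. pos \<alpha> \<longrightarrow> Q (group_conj G (S_elt g) (T_elt g \<alpha>), J\<alpha>_elt G g t \<alpha>)) \<and>
   (\<forall>\<alpha>. pos \<alpha> \<longrightarrow> Q (group_conj G (J\<alpha>_elt G g t \<alpha>) (T_elt g \<alpha>), S_elt g)) \<and>
   (\<forall>\<alpha> \<beta>. pos \<alpha> \<and> pos \<beta> \<longrightarrow>
      Q (T_elt g \<alpha> \<otimes> J_elt g \<otimes> T_elt g \<beta>,
         T_elt g (\<alpha> + \<beta>) \<otimes> R_elt G g (t \<alpha> * t \<beta> / t (\<alpha> + \<beta>))))"
  unfolding GL2_relations_def Let_def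
  by (simp only: ball_Un ball_pairs1 ball_pairs2 ball_simps Diff_iff Units_iff pos_def singleton_iff simp_thms
      conj_assoc)

end

section \<open>Bruhat decomposition of a group satisfying the relations\<close>

text \<open>The group is arbitrary here; the presented group becomes an instance at the end.
  Generation by the \<open>g x\<close> enters only as the premise of \<open>bij_betw_GL2\<close>
  that two cells cover the carrier.\<close>

locale GL2_relators = valued_field v t + group G
  for v :: "'k::field \<Rightarrow> 'g::linordered_ab_group_add" and t :: "'g \<Rightarrow> 'k"
    and G :: "('a, 'b) monoid_scheme" (structure) +
  fixes g :: "('k, 'g) generator \<Rightarrow> 'a" and \<kk> :: "'k set"
  assumes g_closed: "x \<in> generators v \<Longrightarrow> g x \<in> carrier G"
    and rel: "(l, r) \<in> GL2_relations G g t v \<kk> \<Longrightarrow> l = r"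
begin

abbreviation "R \<equiv> R_elt G g"
abbreviation "S \<equiv> S_elt g"
abbreviation "J \<equiv> J_elt g"
abbreviation "T \<equiv> T_elt g"
abbreviation "Z \<equiv> Z_elt G g"
abbreviation "Zt \<equiv> Zt_elt G g"
abbreviation "S\<alpha> \<equiv> S\<alpha>_elt G g t"
abbreviation "J\<alpha> \<equiv> J\<alpha>_elt G g t"

lemma R_closed [simp]: "unit a \<Longrightarrow> R a \<in> carrier G"
  and S_closed [simp]: "S \<in> carrier G"
  and J_closed [simp]: "J \<in> carrier G"
  and T_closed [simp]: "pos \<alpha> \<Longrightarrow> T \<alpha> \<in> carrier G"
  by (auto simp: R_elt_def S_elt_def J_elt_def T_elt_def generators_def Units_iff intro!: g_closed)

lemma R_one [simp]: "R 1 = \<one>" and Z_one [simp]: "Z 1 = \<one>"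
  by (simp_all add: R_elt_def Z_elt_def)

lemma Z_closed [simp]: "unit a \<Longrightarrow> Z a \<in> carrier G"
  and Zt_closed [simp]: "pos \<alpha> \<Longrightarrow> Zt \<alpha> \<in> carrier G"
  by (simp_all add: Z_elt_def Zt_elt_def)

lemma S\<alpha>_closed [simp]: "pos \<alpha> \<Longrightarrow> S\<alpha> \<alpha> \<in> carrier G"
  and J\<alpha>_closed [simp]: "pos \<alpha> \<Longrightarrow> J\<alpha> \<alpha> \<in> carrier G"
  by (simp_all add: S\<alpha>_elt_def J\<alpha>_elt_def group_commutator_def)

lemma relations_hold: "\<forall>p\<in>GL2_relations G g t v \<kk>. fst p = snd p"
  using rel by auto

lemmas relations = relations_hold[unfolded ball_GL2_relations fst_conv snd_conv]

text \<open>The relations are imposed for parameters other than 1; the conventions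
  \<open>R 1 = \<one>\<close> and \<open>Z 1 = \<one>\<close> extend this and the following ones to
  all units.\<close>

lemma R_mult: "unit a \<Longrightarrow> unit b \<Longrightarrow> R a \<otimes> R b = R (a * b)"
  using relations by (cases "a = 1"; cases "b = 1"; simp)

lemma Z_mult: "unit a \<Longrightarrow> unit b \<Longrightarrow> Z a \<otimes> Z b = Z (a * b)"
  using relations by (cases "a = 1"; cases "b = 1"; simp)

lemma Z_R: "unit a \<Longrightarrow> unit b \<Longrightarrow> Z b \<otimes> R a = R a \<otimes> Z b"
  using relations by (cases "a = 1"; cases "b = 1"; simp add: commutator_eq_one_iff)

lemma Z_S: "unit a \<Longrightarrow> Z a \<otimes> S = S \<otimes> Z a"
  using relations by (cases "a = 1"; simp add: commutator_eq_one_iff)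

lemma SS: "S \<otimes> S = \<one>" and JJ: "J \<otimes> J = \<one>"
  using relations by (simp_all add: square_eq)

lemma SS' [simp]: "w \<in> carrier G \<Longrightarrow> S \<otimes> (S \<otimes> w) = w"
  and JJ' [simp]: "w \<in> carrier G \<Longrightarrow> J \<otimes> (J \<otimes> w) = w"
  by (simp_all add: m_assoc[symmetric] SS JJ)

text \<open>The braid form of \<open>(J S)^3 = 1\<close> for the involutions \<open>J\<close> and
  \<open>S\<close>; it is the source of the Bruhat relation \<open>J_E_J\<close>.\<close>

lemma JSJ: "J \<otimes> S \<otimes> J = S \<otimes> J \<otimes> S"
proof -
  have "J \<otimes> (S \<otimes> (J \<otimes> (S \<otimes> (J \<otimes> S)))) = \<one>"
    using relations by (simp add: numeral_3_eq_3 m_assoc)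
  then have "S \<otimes> J \<otimes> (J \<otimes> (S \<otimes> (J \<otimes> (S \<otimes> (J \<otimes> S))))) = S \<otimes> J" by simp
  then have "J \<otimes> S \<otimes> J \<otimes> S = S \<otimes> J" by (simp add: m_assoc)
  then have "J \<otimes> S \<otimes> J \<otimes> S \<otimes> S = S \<otimes> J \<otimes> S" by simp
  then show ?thesis by (simp add: m_assoc SS)
qed

lemma Z_T: "unit a \<Longrightarrow> pos \<alpha> \<Longrightarrow> Z a \<otimes> T \<alpha> = T \<alpha> \<otimes> Z a"
  using relations by (cases "a = 1"; simp add: commutator_eq_one_iff)

lemma Zt_T: "pos \<gamma> \<Longrightarrow> pos \<alpha> \<Longrightarrow> Zt \<gamma> \<otimes> T \<alpha> = T \<alpha> \<otimes> Zt \<gamma>"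
  using relations by (simp add: commutator_eq_one_iff)

lemma inv_R: "unit a \<Longrightarrow> inv R a = R (inverse a)"
  by (rule inv_equality) (simp_all add: R_mult unit_nonzero)

lemma R_T: "unit a \<Longrightarrow> pos \<alpha> \<Longrightarrow> R a \<otimes> T \<alpha> = T \<alpha> \<otimes> (R (inverse a) \<otimes> Z a)"
  using relations by (cases "a = 1"; simp add: conj_eq_iff inv_R)

lemma S_T: "pos \<alpha> \<Longrightarrow> S \<otimes> T \<alpha> = T \<alpha> \<otimes> J\<alpha> \<alpha>"
  and J\<alpha>_T: "pos \<alpha> \<Longrightarrow> J\<alpha> \<alpha> \<otimes> T \<alpha> = T \<alpha> \<otimes> S"
  using relations by (simp_all add: conj_eq_iff)

lemma T_J_T: "pos \<alpha> \<Longrightarrow> pos \<beta> \<Longrightarrow>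
    T \<alpha> \<otimes> J \<otimes> T \<beta> = T (\<alpha> + \<beta>) \<otimes> R (t \<alpha> * t \<beta> / t (\<alpha> + \<beta>))"
  using relations by simp

lemma Z_eq: "unit a \<Longrightarrow> Z a = J \<otimes> R a \<otimes> (J \<otimes> R a)"
  by (simp add: Z_elt_def square_eq JJ)

text \<open>Solves \<open>Z a = (J R a)^2\<close> for \<open>J R a\<close>: conjugation by
  \<open>J\<close> swaps the diagonal entries, so it inverts \<open>R a\<close> up to the scalar
  \<open>Z a\<close>.\<close>

lemma J_R: "unit a \<Longrightarrow> J \<otimes> R a = Z a \<otimes> R (inverse a) \<otimes> J"
  by (simp add: Z_eq m_assoc lift_eq[OF R_mult] unit_nonzero JJ)

text \<open>Both sides equal \<open>R a J R a\<close>: on the left \<open>R a\<close> is split off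
  and moved through \<open>Z a\<close>, on the right \<open>J^2 = 1\<close> cancels.\<close>

lemma Z_J:
  assumes "unit a"
  shows "Z a \<otimes> J = J \<otimes> Z a"
proof -
  have "Z a \<otimes> J = Z a \<otimes> R a \<otimes> R (inverse a) \<otimes> J"
    using assms by (simp add: m_assoc lift_eq[OF R_mult] unit_nonzero)
  also have "\<dots> = R a \<otimes> (J \<otimes> R a)"
    using assms by (simp add: Z_R m_assoc J_R)
  also have "\<dots> = J \<otimes> Z a"
    using assms by (simp add: Z_eq m_assoc)
  finally show ?thesis .
qed

lemma Zt_eq: "pos \<alpha> \<Longrightarrow> Zt \<alpha> = T \<alpha> \<otimes> T \<alpha>"
  by (simp add: Zt_elt_def square_eq)

text \<open>Each passage through \<open>T \<alpha>\<close> inverts \<open>R a\<close>; after two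
  passages it is restored, and the factors \<open>Z a\<close> and \<open>Z (inverse a)\<close>
  cancel.\<close>

lemma Zt_R:
  assumes "unit a" "pos \<alpha>"
  shows "Zt \<alpha> \<otimes> R a = R a \<otimes> Zt \<alpha>"
proof -
  have "R a \<otimes> Zt \<alpha> = T \<alpha> \<otimes> (R (inverse a) \<otimes> Z a) \<otimes> T \<alpha>"
    using assms by (simp add: Zt_eq R_T[symmetric] m_assoc)
  also have "\<dots> = T \<alpha> \<otimes> (R (inverse a) \<otimes> T \<alpha> \<otimes> Z a)"
    using assms by (simp add: m_assoc Z_T)
  also have "\<dots> = T \<alpha> \<otimes> T \<alpha> \<otimes> R a \<otimes> (Z (inverse a) \<otimes> Z a)"
    using assms by (simp add: R_T m_assoc)
  also have "\<dots> = Zt \<alpha> \<otimes> R a"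
    using assms by (simp add: Z_mult unit_nonzero Zt_eq)
  finally show ?thesis by simp
qed

text \<open>Conjugation by \<open>T \<alpha>\<close> exchanges \<open>S\<close> and
  \<open>J\<alpha> \<alpha>\<close>, so its square fixes \<open>S\<close>.\<close>

lemma Zt_S:
  assumes "pos \<alpha>"
  shows "Zt \<alpha> \<otimes> S = S \<otimes> Zt \<alpha>"
proof -
  have "S \<otimes> Zt \<alpha> = T \<alpha> \<otimes> (J\<alpha> \<alpha> \<otimes> T \<alpha>)"
    using assms by (simp add: Zt_eq lift_eq[OF S_T] m_assoc)
  also have "\<dots> = Zt \<alpha> \<otimes> S"
    using assms by (simp add: J\<alpha>_T Zt_eq m_assoc)
  finally show ?thesis by simp
qed

text \<open>\<open>J\<close> is a word in the \<open>T\<^sub>\<alpha>\<close> and \<open>R(a)\<close>, by the relation for \<open>T\<^sub>\<alpha> J T\<^sub>\<alpha>\<close>.\<close>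

lemma Zt_J:
  assumes "pos \<alpha>"
  shows "Zt \<alpha> \<otimes> J = J \<otimes> Zt \<alpha>"
proof -
  let ?z = "Zt \<alpha>" and ?T = "T \<alpha>"
  have u: "unit (t \<alpha> * t \<alpha> / t (\<alpha> + \<alpha>))" using unit_u[of \<alpha> \<alpha>] assms by simp
  have "?z \<otimes> (?T \<otimes> J \<otimes> ?T) = ?T \<otimes> J \<otimes> ?T \<otimes> ?z"
    unfolding T_J_T[OF assms assms]
    using assms u by (intro commute_mult Zt_T Zt_R) (auto simp: pos_add)
  then have "?T \<otimes> ((?z \<otimes> J) \<otimes> ?T) = ?T \<otimes> ((J \<otimes> ?z) \<otimes> ?T)"
    using assms by (simp add: m_assoc lift_eq[OF Zt_T] Zt_T)
  then show ?thesis using assms by simp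
qed

section \<open>Diagonal elements for the chosen elements of given value\<close>

definition D :: "'g \<Rightarrow> 'a" where "D \<alpha> = (if \<alpha> = 0 then \<one> else J \<otimes> T \<alpha>)"

text \<open>There is no generator \<open>T 0\<close>; the default \<open>\<one>\<close> agrees with
  \<open>t 0 = 1\<close> and lets the index range over all nonnegative values.\<close>

lemma D_zero [simp]: "D 0 = \<one>"
  by (simp add: D_def)

lemma D_closed [simp]: "\<alpha> \<in> nonneg_values v \<Longrightarrow> D \<alpha> \<in> carrier G"
  by (simp add: D_def pos_def del: posD)

text \<open>Both \<open>J\<close> and \<open>T \<alpha>\<close> invert \<open>R a\<close> up to a
  factor \<open>Z\<close>; in the product \<open>J T \<alpha>\<close> the inversions undo each other
  and the factors cancel.\<close>

lemma R_D:
  assumes "unit a" "\<alpha> \<in> nonneg_values v"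
  shows "R a \<otimes> D \<alpha> = D \<alpha> \<otimes> R a"
proof (cases "\<alpha> = 0")
  case False
  then have pos: "pos \<alpha>" using assms by (simp add: pos_def del: posD)
  have "D \<alpha> \<otimes> R a = J \<otimes> (T \<alpha> \<otimes> R a)" using assms pos False by (simp add: D_def m_assoc)
  \<comment> \<open>The trivial factor \<open>Z (inverse a) \<otimes> Z a\<close> is inserted so
    that \<open>R_T\<close> for \<open>inverse a\<close> can be read from right to left.\<close>
  also have "T \<alpha> \<otimes> R a = T \<alpha> \<otimes> (R (inverse (inverse a)) \<otimes> Z (inverse a)) \<otimes> Z a"
    using assms pos by (simp add: m_assoc Z_mult unit_nonzero)
  also have "\<dots> = R (inverse a) \<otimes> T \<alpha> \<otimes> Z a"
    using assms pos R_T[of "inverse a" \<alpha>] by simp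
  also have "\<dots> = R (inverse a) \<otimes> Z a \<otimes> T \<alpha>"
    using assms pos by (simp add: m_assoc Z_T)
  also have "J \<otimes> \<dots> = J \<otimes> R (inverse a) \<otimes> (Z a \<otimes> T \<alpha>)"
    using assms pos by (simp add: m_assoc)
  also have "\<dots> = Z (inverse a) \<otimes> R a \<otimes> (J \<otimes> Z a) \<otimes> T \<alpha>"
    using assms pos by (simp add: J_R m_assoc)
  also have "\<dots> = Z (inverse a) \<otimes> (R a \<otimes> Z a) \<otimes> J \<otimes> T \<alpha>"
    using assms pos by (simp add: Z_J[symmetric] m_assoc)
  also have "\<dots> = (Z (inverse a) \<otimes> Z a) \<otimes> R a \<otimes> J \<otimes> T \<alpha>"
    using assms pos by (simp add: Z_R[symmetric] m_assoc)
  also have "\<dots> = R a \<otimes> D \<alpha>"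
    using assms pos False by (simp add: Z_mult unit_nonzero D_def m_assoc)
  finally show ?thesis by simp
qed (use assms in \<open>simp add: D_def\<close>)

text \<open>This is the relation for \<open>T \<alpha> J T \<beta>\<close> multiplied by
  \<open>J\<close> on the left; if one index is 0, the unit is 1.\<close>

lemma D_mult:
  assumes "\<alpha> \<in> nonneg_values v" "\<beta> \<in> nonneg_values v"
  shows "D \<alpha> \<otimes> D \<beta> = D (\<alpha> + \<beta>) \<otimes> R (t \<alpha> * t \<beta> / t (\<alpha> + \<beta>))"
proof (cases "\<alpha> = 0 \<or> \<beta> = 0")
  case True
  then show ?thesis using assms by auto
next
  case False
  then have pos: "pos \<alpha>" "pos \<beta>" using assms by (auto simp: pos_def simp del: posD)
  have "D \<alpha> \<otimes> D \<beta> = J \<otimes> (T \<alpha> \<otimes> J \<otimes> T \<beta>)"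
    using False pos by (simp add: D_def m_assoc)
  also have "\<dots> = D (\<alpha> + \<beta>) \<otimes> R (t \<alpha> * t \<beta> / t (\<alpha> + \<beta>))"
    unfolding T_J_T[OF pos]
    using pos pos_add[OF pos] unit_u[OF assms] by (simp add: D_def m_assoc)
  finally show ?thesis .
qed

text \<open>Since \<open>J\<alpha> \<alpha> = J S\<alpha> J\<close>, this is the relation taking
  \<open>J\<alpha> \<alpha>\<close> to \<open>S\<close> under conjugation by
  \<open>T \<alpha>\<close>, multiplied by \<open>J\<close>.\<close>

lemma D_S:
  assumes "pos \<alpha>"
  shows "D \<alpha> \<otimes> S = S\<alpha> \<alpha> \<otimes> D \<alpha>"
proof -
  have "D \<alpha> \<otimes> S = J \<otimes> (J\<alpha> \<alpha> \<otimes> T \<alpha>)"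
    using assms by (simp add: D_def J\<alpha>_T m_assoc)
  also have "\<dots> = S\<alpha> \<alpha> \<otimes> D \<alpha>"
    using assms by (simp add: D_def J\<alpha>_elt_def m_assoc)
  finally show ?thesis .
qed

section \<open>Elements commuting with all generators\<close>

definition central :: "'a \<Rightarrow> bool" where
  "central z \<longleftrightarrow> z \<in> carrier G \<and> (\<forall>x\<in>generators v. z \<otimes> g x = g x \<otimes> z)"

lemma centralI:
  assumes "z \<in> carrier G" "\<And>a. unit a \<Longrightarrow> z \<otimes> R a = R a \<otimes> z" "z \<otimes> S = S \<otimes> z" "z \<otimes> J = J \<otimes> z"
    "\<And>\<alpha>. pos \<alpha> \<Longrightarrow> z \<otimes> T \<alpha> = T \<alpha> \<otimes> z"
  shows "central z"
proof -
  have "z \<otimes> g x = g x \<otimes> z" if "x \<in> generators v" for x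
    \<comment> \<open>The case expression names the parameter of a generator \<open>Gen_R a\<close>
      before the cases are split.\<close>
    using that assms(2)[of "case x of Gen_R a \<Rightarrow> a"] assms(3-)
    by (cases x)
      (auto simp: generators_def Units_iff pos_def R_elt_def S_elt_def J_elt_def T_elt_def
        simp del: posD split: if_splits)
  then show ?thesis
    using assms(1) by (simp add: central_def)
qed

lemma central_closed [simp]: "central z \<Longrightarrow> z \<in> carrier G"
  by (simp add: central_def)

lemma central_R: "central z \<Longrightarrow> unit a \<Longrightarrow> z \<otimes> R a = R a \<otimes> z"
  and central_S: "central z \<Longrightarrow> z \<otimes> S = S \<otimes> z"
  and central_J: "central z \<Longrightarrow> z \<otimes> J = J \<otimes> z"
  and central_T: "central z \<Longrightarrow> pos \<alpha> \<Longrightarrow> z \<otimes> T \<alpha> = T \<alpha> \<otimes> z"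
  by (auto simp: central_def R_elt_def S_elt_def J_elt_def T_elt_def generators_def Units_iff pos_def simp del: posD)

lemma central_D: "central z \<Longrightarrow> \<alpha> \<in> nonneg_values v \<Longrightarrow> z \<otimes> D \<alpha> = D \<alpha> \<otimes> z"
  by (auto simp: D_def pos_def simp del: posD intro!: commute_mult central_J central_T)

lemma central_mult: "central z \<Longrightarrow> central w \<Longrightarrow> central (z \<otimes> w)"
  using g_closed commute_mult[of "g _" z w] by (simp add: central_def)

lemma central_inv: "central z \<Longrightarrow> central (inv z)"
  using g_closed commute_inv[of "g _" z] by (simp add: central_def)

lemma central_Z: "unit a \<Longrightarrow> central (Z a)"
  by (intro centralI) (simp_all add: Z_R Z_S Z_J Z_T)

lemma central_Zt: "pos \<alpha> \<Longrightarrow> central (Zt \<alpha>)"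
  by (intro centralI) (simp_all add: Zt_R Zt_S Zt_J Zt_T)

section \<open>Multiplicative extension of the diagonal elements to all nonzero scalars\<close>

definition RO :: "'k \<Rightarrow> 'a" where "RO x = R (x / t (v x)) \<otimes> D (v x)"

definition integral :: "'k \<Rightarrow> bool" where "integral x \<longleftrightarrow> x \<noteq> 0 \<and> 0 \<le> v x"

lemma integral_simps [simp]:
  "integral x \<Longrightarrow> integral y \<Longrightarrow> integral (x * y)" "integral 1" "unit x \<Longrightarrow> integral x"
  by (auto simp: integral_def unit_def)

lemma integralD [simp]:
  assumes "integral x"
  shows "x \<noteq> 0" "v x \<in> nonneg_values v" "unit (x / t (v x))"
  using assms nonneg_valuesI[of x] by (auto simp: integral_def unit_def)

lemma RO_closed [simp]: "integral x \<Longrightarrow> RO x \<in> carrier G"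
  by (simp add: RO_def)

lemma RO_unit: "unit a \<Longrightarrow> RO a = R a"
  by (simp add: RO_def unit_def[of a] D_def)

text \<open>The unit by which \<open>D\<close> fails to be multiplicative is exactly the discrepancy
  between the product of the unit parts of \<open>x\<close> and \<open>y\<close> and the unit part
  of \<open>x * y\<close>.\<close>

lemma RO_mult:
  assumes "integral x" "integral y"
  shows "RO x \<otimes> RO y = RO (x * y)"
proof -
  let ?a = "x / t (v x)" and ?b = "y / t (v y)" and ?u = "t (v x) * t (v y) / t (v x + v y)"
  have u: "unit ?u" using assms by (intro unit_u) simp_all
  have "RO x \<otimes> RO y = R ?a \<otimes> (D (v x) \<otimes> R ?b) \<otimes> D (v y)"
    using assms by (simp add: RO_def m_assoc)
  also have "\<dots> = R ?a \<otimes> R ?b \<otimes> (D (v x) \<otimes> D (v y))"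
    using assms by (simp add: R_D[symmetric] m_assoc)
  also have "\<dots> = R ?a \<otimes> R ?b \<otimes> (R ?u \<otimes> D (v x + v y))"
    using assms u by (simp add: D_mult R_D)
  also have "\<dots> = R (?a * ?b * ?u) \<otimes> D (v x + v y)"
    using assms u by (simp only: R_mult[symmetric] integralD unit_simps R_closed D_closed
        nonneg_values_add m_assoc m_closed)
  also have "?a * ?b * ?u = (x * y) / t (v (x * y))"
    using assms by simp
  finally show ?thesis using assms by (simp add: RO_def)
qed

lemma RO_comm: "integral x \<Longrightarrow> integral y \<Longrightarrow> RO x \<otimes> RO y = RO y \<otimes> RO x"
  by (simp add: RO_mult mult.commute)

text \<open>One of \<open>x\<close> and \<open>inverse x\<close> is integral for every nonzero
  \<open>x\<close>, so no choice of a fraction is involved.\<close>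

definition RK :: "'k \<Rightarrow> 'a" where
  "RK x = (if 0 \<le> v x then RO x else inv (RO (inverse x)))"

lemma integral_cases:
  assumes "x \<noteq> 0"
  obtains "integral x" "RK x = RO x" | "integral (inverse x)" "RK x = inv (RO (inverse x))"
  using assms that by (cases "0 \<le> v x") (auto simp: integral_def RK_def simp del: integralD)

lemma RK_closed [simp]: "x \<noteq> 0 \<Longrightarrow> RK x \<in> carrier G"
  by (erule integral_cases) simp_all

lemma RK_unit: "unit a \<Longrightarrow> RK a = R a"
  by (simp add: RK_def RO_unit unit_def[of a] del: v_divide)

lemma RK_t: "pos \<alpha> \<Longrightarrow> RK (t \<alpha>) = D \<alpha>"
  by (simp add: RK_def RO_def)

lemma RK_RO_comm: "x \<noteq> 0 \<Longrightarrow> integral y \<Longrightarrow> RK x \<otimes> RO y = RO y \<otimes> RK x"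
  by (erule integral_cases) (simp_all add: RO_comm commute_inv)

text \<open>Determines \<open>RK\<close> on a fraction from any integral numerator and denominator.
  Multiplicativity then follows by clearing denominators instead of comparing signs of
  values.\<close>

lemma RK_fraction:
  assumes "integral p" "integral q"
  shows "RK (p / q) \<otimes> RO q = RO p"
proof -
  have "p / q \<noteq> 0" using assms by simp
  then show ?thesis
  proof (cases rule: integral_cases)
    case 1
    then show ?thesis using assms by (simp add: RO_mult)
  next
    case 2
    have "RO (inverse (p / q)) \<otimes> RO p = RO q"
      using assms 2(1) RO_mult[OF 2(1) assms(1)] by (simp add: field_simps)
    then show ?thesis using assms 2 by (simp add: inv_solve_left')
  qed
qed

lemma fraction:
  assumes "x \<noteq> 0"
  obtains p q where "integral p" "integral q" "x = p / q"
  using assms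
proof (cases rule: integral_cases)
  case 1
  then show ?thesis using that[of x 1] by simp
next
  case 2
  then show ?thesis using that[of 1 "inverse x"] by (simp add: divide_inverse)
qed

lemma RK_mult:
  assumes "x \<noteq> 0" "y \<noteq> 0"
  shows "RK x \<otimes> RK y = RK (x * y)"
proof -
  obtain p q where x: "integral p" "integral q" "x = p / q" using fraction[OF assms(1)] .
  obtain r s where y: "integral r" "integral s" "y = r / s" using fraction[OF assms(2)] .
  have "RK (x * y) \<otimes> RO (q * s) = RO (p * r)"
    using RK_fraction[of "p * r" "q * s"] x y by simp
  also have "\<dots> = (RK x \<otimes> RO q) \<otimes> (RK y \<otimes> RO s)"
    using x y RK_fraction by (simp add: RO_mult)
  also have "\<dots> = RK x \<otimes> (RO q \<otimes> RK y) \<otimes> RO s"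
    using assms x(1,2) y(1,2) by (simp add: m_assoc)
  also have "\<dots> = RK x \<otimes> RK y \<otimes> (RO q \<otimes> RO s)"
    using assms x(1,2) y(1,2) by (simp add: RK_RO_comm[symmetric] m_assoc)
  finally show ?thesis
    using assms x(1,2) y(1,2) by (simp add: RO_mult)
qed

lemma RK_one [simp]: "RK 1 = \<one>"
  by (simp add: RK_unit)

lemma central_RK: "central z \<Longrightarrow> x \<noteq> 0 \<Longrightarrow> z \<otimes> RK x = RK x \<otimes> z"
  by (erule integral_cases)
    (auto simp: RO_def intro!: commute_inv commute_mult central_R central_D simp del: v_inverse)

section \<open>Scalar elements\<close>

definition ZK :: "'k \<Rightarrow> 'a" where "ZK x = J \<otimes> RK x \<otimes> (J \<otimes> RK x)"

text \<open>Moving the unit part of \<open>RO x\<close> through \<open>J\<close> splits the square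
  into \<open>Z\<close> of that unit and \<open>(J D)^2\<close>. The latter is \<open>\<one>\<close>
  for value 0 and otherwise some \<open>Zt\<close>, because \<open>J D = T\<close>.\<close>

lemma central_J_RO:
  assumes "integral x"
  shows "central (J \<otimes> RO x \<otimes> (J \<otimes> RO x))"
proof -
  let ?a = "x / t (v x)"
  have D: "central (J \<otimes> D (v x) \<otimes> (J \<otimes> D (v x)))"
  proof (cases "v x = 0")
    case True
    then show ?thesis by (simp add: D_def JJ centralI)
  next
    case False
    then have "pos (v x)" using assms by (simp add: pos_def del: posD)
    then show ?thesis using False central_Zt[of "v x"] by (simp add: D_def Zt_eq)
  qed
  have "inverse ?a * ?a = 1" using assms by (intro left_inverse unit_nonzero integralD)
  then have inv: "R (inverse ?a) \<otimes> R ?a = \<one>"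
    by (simp only: R_mult unit_simps integralD[OF assms] R_one)
  have "J \<otimes> RO x \<otimes> (J \<otimes> RO x) = (J \<otimes> R ?a) \<otimes> D (v x) \<otimes> (J \<otimes> D (v x)) \<otimes> R ?a"
    using assms by (simp add: RO_def m_assoc R_D)
  also have "\<dots> = Z ?a \<otimes> R (inverse ?a) \<otimes> ((J \<otimes> D (v x) \<otimes> (J \<otimes> D (v x))) \<otimes> R ?a)"
    using assms by (simp add: J_R m_assoc del: inverse_divide)
  also have "\<dots> = Z ?a \<otimes> (R (inverse ?a) \<otimes> R ?a) \<otimes> (J \<otimes> D (v x) \<otimes> (J \<otimes> D (v x)))"
    using assms unfolding central_R[OF D integralD(3)[OF assms]]
    by (simp add: m_assoc del: inverse_divide)
  also have "\<dots> = Z ?a \<otimes> (J \<otimes> D (v x) \<otimes> (J \<otimes> D (v x)))"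
    using assms by (simp add: inv del: inverse_divide)
  finally show ?thesis
    using assms D central_Z central_mult by simp
qed

lemma central_ZK:
  assumes "x \<noteq> 0"
  shows "central (ZK x)"
  using assms
proof (cases rule: integral_cases)
  case 1
  then show ?thesis using central_J_RO by (simp add: ZK_def)
next
  case 2
  let ?r = "RO (inverse x)"
  have inv_J: "inv J = J" using JJ by (intro inv_equality) simp_all
  have c: "central (J \<otimes> ?r \<otimes> (J \<otimes> ?r))" by (rule central_J_RO[OF 2(1)])
  \<comment> \<open>The square for \<open>x\<close> is the conjugate by \<open>J\<close> of the
    inverse of the square for \<open>inverse x\<close>; centrality removes the conjugation.\<close>
  have "ZK x = J \<otimes> inv (J \<otimes> ?r \<otimes> (J \<otimes> ?r)) \<otimes> J"
    using 2 by (simp add: ZK_def inv_mult_group inv_J m_assoc JJ)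
  also have "\<dots> = inv (J \<otimes> ?r \<otimes> (J \<otimes> ?r)) \<otimes> J \<otimes> J"
    by (simp only: central_J[OF central_inv[OF c]])
  also have "\<dots> = inv (J \<otimes> ?r \<otimes> (J \<otimes> ?r))"
    using central_inv[OF c] by (simp only: m_assoc JJ r_one central_closed J_closed)
  finally show ?thesis using central_inv[OF c] by simp
qed

lemma ZK_closed [simp]: "x \<noteq> 0 \<Longrightarrow> ZK x \<in> carrier G"
  by (simp add: central_ZK)

lemma J_RK:
  assumes "x \<noteq> 0"
  shows "J \<otimes> RK x = ZK x \<otimes> RK (inverse x) \<otimes> J"
  using assms by (simp add: ZK_def m_assoc lift_eq[OF RK_mult] JJ)

text \<open>\<open>J\<close> is moved through \<open>RK (x * y)\<close> once as a whole and once
  factor by factor; the two results differ only in their \<open>ZK\<close> parts.\<close>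

lemma ZK_mult:
  assumes "x \<noteq> 0" "y \<noteq> 0"
  shows "ZK x \<otimes> ZK y = ZK (x * y)"
proof -
  let ?w = "RK (inverse (x * y)) \<otimes> J"
  have "ZK (x * y) \<otimes> ?w = J \<otimes> RK x \<otimes> RK y"
    using assms J_RK[of "x * y"] by (simp add: m_assoc RK_mult del: inverse_mult_distrib)
  also have "\<dots> = ZK x \<otimes> RK (inverse x) \<otimes> (J \<otimes> RK y)"
    unfolding J_RK[OF assms(1)] using assms by (simp add: m_assoc)
  also have "\<dots> = ZK x \<otimes> (RK (inverse x) \<otimes> ZK y) \<otimes> (RK (inverse y) \<otimes> J)"
    unfolding J_RK[OF assms(2)] using assms by (simp add: m_assoc)
  also have "\<dots> = ZK x \<otimes> ZK y \<otimes> (RK (inverse x) \<otimes> RK (inverse y) \<otimes> J)"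
    using assms by (simp add: central_RK[OF central_ZK, symmetric] m_assoc)
  also have "\<dots> = ZK x \<otimes> ZK y \<otimes> ?w"
    using assms by (simp add: RK_mult)
  finally show ?thesis using assms by simp
qed

lemma ZK_one [simp]: "ZK 1 = \<one>"
  by (simp add: ZK_def JJ)

section \<open>Unipotent elements and their additivity\<close>

text \<open>For nonzero \<open>x\<close> this is the conjugate of \<open>S R(-1)\<close> by
  \<open>RK x\<close>, with the last two factors merged into one; it stands for
  \<open>mat2 1 x 0 1\<close>. The value at 0 is set separately because 0 has no diagonal
  element.\<close>

definition E :: "'k \<Rightarrow> 'a" where
  "E x = (if x = 0 then \<one> else RK x \<otimes> S \<otimes> RK (- inverse x))"

lemma E_closed [simp]: "E x \<in> carrier G"
  by (simp add: E_def)

lemma E_zero [simp]: "E 0 = \<one>"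
  by (simp add: E_def)

lemma RK_E:
  assumes "y \<noteq> 0"
  shows "RK y \<otimes> E x = E (y * x) \<otimes> RK y"
proof (cases "x = 0")
  case False
  have "RK (- inverse (y * x)) \<otimes> RK y = RK (- inverse x)"
    using assms False by (subst RK_mult) (simp_all add: field_simps)
  then show ?thesis
    using assms False by (simp add: E_def m_assoc lift_eq[OF RK_mult] del: inverse_mult_distrib)
qed (use assms in simp)

text \<open>\<open>D \<alpha>\<close> turns \<open>S\<close> into \<open>S\<alpha> \<alpha>\<close>,
  whose final \<open>R (-1)\<close> cancels against the remaining \<open>RK\<close> factors of
  \<open>E\<close>.\<close>

lemma E_t:
  assumes "pos \<alpha>"
  shows "E (t \<alpha>) = group_commutator G S (R (1 - t \<alpha>))"
proof -
  have u: "unit (-1)" by simp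
  have "E (t \<alpha>) = S\<alpha> \<alpha> \<otimes> (RK (t \<alpha>) \<otimes> RK (- inverse (t \<alpha>)))"
    using assms by (simp add: E_def RK_t D_S m_assoc)
  also have "\<dots> = S\<alpha> \<alpha> \<otimes> R (-1)"
    using assms by (simp add: RK_mult RK_unit)
  also have "\<dots> = group_commutator G S (R (1 - t \<alpha>)) \<otimes> (R (-1) \<otimes> R (-1))"
    using assms by (simp add: S\<alpha>_elt_def m_assoc group_commutator_def)
  also have "\<dots> = group_commutator G S (R (1 - t \<alpha>))"
    using assms by (simp add: R_mult group_commutator_def)
  finally show ?thesis .
qed

text \<open>For \<open>x\<close> in the maximal ideal, \<open>E x\<close> is the commutator of
  \<open>S\<close> and \<open>R (1 - x)\<close>: \<open>E_t\<close> treats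
  \<open>x = t \<alpha>\<close>, and the relation for \<open>[S, R(1 - a t)]\<close> says that this
  commutator scales with \<open>a\<close> just as \<open>E\<close> does.\<close>

lemma E_RK_ideal:
  assumes "x = 0 \<or> 0 < v x"
  shows "E x \<otimes> RK (1 - x) = S \<otimes> RK (1 - x) \<otimes> S"
proof (cases "x = 0")
  case False
  let ?\<alpha> = "v x" and ?a = "x / t (v x)"
  have x: "integral x" and pos: "pos ?\<alpha>"
    using assms False nonneg_valuesI[of x] by (auto simp: integral_def pos_def simp del: posD integralD)
  have a: "unit ?a" "?a \<noteq> 0" and xa: "x = ?a * t ?\<alpha>" using x by simp_all
  have u: "unit (1 - x)" using one_minus_unit[of x] assms by (simp add: unit_def)
  have inv_S: "inv S = S" using SS by (intro inv_equality) simp_all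
  have "E x \<otimes> RK ?a = RK ?a \<otimes> E (t ?\<alpha>)"
    using RK_E[of ?a "t ?\<alpha>"] a xa by simp
  then have "E x = RK ?a \<otimes> E (t ?\<alpha>) \<otimes> inv RK ?a"
    using a by (simp add: inv_solve_right)
  also have "\<dots> = group_commutator G S (R (1 - ?a * t ?\<alpha>))"
  proof (cases "?a = 1")
    case False
    then have "group_commutator G S (R (1 - ?a * t ?\<alpha>)) =
        R ?a \<otimes> group_commutator G S (R (1 - t ?\<alpha>)) \<otimes> inv R ?a"
      using relations pos a by blast
    then show ?thesis
      using pos a by (simp only: RK_unit E_t)
  next
    case True
    show ?thesis
      unfolding True by (simp add: E_t pos group_commutator_def)
  qed
  also have "1 - ?a * t ?\<alpha> = 1 - x" using xa by simp
  finally show ?thesis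
    using u by (simp add: group_commutator_def m_assoc inv_S RK_unit)
qed (simp add: SS)

text \<open>
  Since \<open>y \<mapsto> S RK(y) S\<close> is multiplicative, \<open>E(x) RK(1 - x)\<close> is multiplicative in \<open>1 - x\<close>; moving
  the factors \<open>RK\<close> to the right leaves additivity of \<open>E\<close>.
\<close>

lemma E_add_ideal:
  assumes x: "x = 0 \<or> 0 < v x" and y: "y = 0 \<or> 0 < v y"
  shows "E x \<otimes> E y = E (x + y)"
proof -
  \<comment> \<open>Chosen so that \<open>(1 - x) * (1 - z) = 1 - (x + y)\<close>; moving
    \<open>RK (1 - x)\<close> past \<open>E z\<close> rescales it to \<open>E y\<close>.\<close>
  define z where "z = y / (1 - x)"
  note x1 = one_minus_unit[OF x]
  have z: "z = 0 \<or> 0 < v z" using y x1 by (cases "y = 0") (auto simp: z_def)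
  note z1 = one_minus_unit[OF z]
  have y_eq: "y = (1 - x) * z" using x1 by (simp add: z_def)
  have prod: "(1 - x) * (1 - z) = 1 - (x + y)" using y_eq by (simp add: algebra_simps)
  have xy: "x + y = 0 \<or> 0 < v (x + y)"
    using x y v_add[of x y]
    by (cases "x = 0"; cases "y = 0"; cases "x + y = 0") (auto simp: min_def split: if_splits)
  note xy1 = one_minus_unit[OF xy]
  have "E (x + y) \<otimes> RK (1 - (x + y)) = S \<otimes> (RK (1 - x) \<otimes> RK (1 - z)) \<otimes> S"
    using E_RK_ideal[OF xy] x1 z1 by (simp add: RK_mult prod)
  also have "\<dots> = (S \<otimes> RK (1 - x) \<otimes> S) \<otimes> (S \<otimes> RK (1 - z) \<otimes> S)"
    using x1 z1 by (simp add: m_assoc)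
  also have "\<dots> = (E x \<otimes> RK (1 - x)) \<otimes> (E z \<otimes> RK (1 - z))"
    by (simp only: E_RK_ideal[OF x] E_RK_ideal[OF z])
  also have "\<dots> = E x \<otimes> (RK (1 - x) \<otimes> E z) \<otimes> RK (1 - z)"
    using x1 z1 by (simp add: m_assoc)
  also have "\<dots> = E x \<otimes> E y \<otimes> (RK (1 - x) \<otimes> RK (1 - z))"
    using x1 z1 by (simp add: RK_E y_eq m_assoc)
  also have "\<dots> = E x \<otimes> E y \<otimes> RK (1 - (x + y))"
    using x1 z1 by (simp add: RK_mult prod)
  finally show ?thesis using xy1 by simp
qed

text \<open>Conjugation by \<open>RK q\<close> multiplies the argument of \<open>E\<close> by
  \<open>q\<close>. A suitable \<open>q\<close> brings \<open>x\<close> and \<open>y\<close> into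
  the maximal ideal, where additivity is known, and is cancelled afterwards.\<close>

lemma E_add: "E x \<otimes> E y = E (x + y)"
proof -
  obtain \<pi> where \<pi>: "\<pi> \<noteq> 0" "0 < v \<pi>" by (rule positive_element)
  have scale: "r * w = 0 \<or> 0 < v (r * w)" if "r \<noteq> 0" "0 \<le> v r" "w = 0 \<or> 0 < v w" for r w
    using that by (cases "w = 0") (auto intro: add_nonneg_pos)
  have bound: "\<exists>s. s \<noteq> 0 \<and> 0 \<le> v s \<and> (s * w = 0 \<or> 0 < v (s * w))" for w
  proof (cases "w \<noteq> 0 \<and> v w < 0")
    case True
    \<comment> \<open>The multiplier is \<open>\<pi> / w\<close>, which sends \<open>w\<close> to
      \<open>\<pi>\<close> and has positive value.\<close>
    then have "v w \<le> v \<pi>" using \<pi> by (intro less_imp_le) (blast intro: less_trans)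
    then show ?thesis using \<pi> True by (intro exI[of _ "\<pi> / w"]) simp
  next
    case False
    then show ?thesis using \<pi>
      by (intro exI[of _ \<pi>], cases "w = 0") (auto simp: add_pos_nonneg less_imp_le not_less)
  qed
  obtain s where s: "s \<noteq> 0" "0 \<le> v s" "s * x = 0 \<or> 0 < v (s * x)" using bound by blast
  obtain r where r: "r \<noteq> 0" "0 \<le> v r" "r * y = 0 \<or> 0 < v (r * y)" using bound by blast
  \<comment> \<open>One multiplier serves both: an additional factor of nonnegative value does not
    leave the ideal.\<close>
  have "r * s * x = 0 \<or> 0 < v (r * s * x)" "r * s * y = 0 \<or> 0 < v (r * s * y)"
    using scale[OF r(1,2) s(3)] scale[OF s(1,2) r(3)] by (simp_all only: ac_simps)
  then have "E (r * s * x) \<otimes> E (r * s * y) = E (r * s * (x + y))"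
    by (simp add: E_add_ideal distrib_left)
  moreover define q where "q = r * s"
  ultimately have add: "E (q * x) \<otimes> E (q * y) = E (q * (x + y))" by simp
  have q: "q \<noteq> 0" using s r by (simp add: q_def)
  have "RK q \<otimes> (E x \<otimes> E y) = E (q * x) \<otimes> (RK q \<otimes> E y)"
    using q by (simp add: lift_eq[OF RK_E] m_assoc)
  also have "\<dots> = E (q * x) \<otimes> E (q * y) \<otimes> RK q"
    using q by (simp add: RK_E m_assoc)
  also have "\<dots> = RK q \<otimes> E (x + y)"
    using q by (simp add: add RK_E)
  finally show ?thesis using q by simp
qed

section \<open>Bruhat cells and their stability under generators\<close>

definition borel :: "'a set" where
  "borel = {ZK z \<otimes> RK y \<otimes> E x | z y x. z \<noteq> 0 \<and> y \<noteq> 0}"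

text \<open>The cell of matrices with nonzero lower left entry. Only a factor \<open>E x\<close> is
  kept to the right of \<open>J\<close>, as scalar and diagonal factors can be moved to its
  left.\<close>

definition big_cell :: "'a set" where
  "big_cell = {b \<otimes> J \<otimes> E x | b x. b \<in> borel}"

lemma borel_closed: "b \<in> borel \<Longrightarrow> b \<in> carrier G"
  by (auto simp: borel_def)

lemma central_E: "central z \<Longrightarrow> z \<otimes> E x = E x \<otimes> z"
  by (auto simp: E_def intro!: commute_mult central_RK central_S)

lemma borelI: "z \<noteq> 0 \<Longrightarrow> y \<noteq> 0 \<Longrightarrow> ZK z \<otimes> RK y \<otimes> E x \<in> borel"
  by (auto simp: borel_def)

lemma ZK_borel: "z \<noteq> 0 \<Longrightarrow> ZK z \<in> borel"
  using borelI[of z 1 0] by simp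

lemma RK_borel: "y \<noteq> 0 \<Longrightarrow> RK y \<in> borel"
  using borelI[of 1 y 0] by simp

lemma E_borel: "E x \<in> borel"
  using borelI[of 1 1 x] by simp

text \<open>The scalars are central and the diagonal elements normalise the \<open>E x\<close>, so
  the factors can be collected by type.\<close>

lemma borel_mult:
  assumes "b \<in> borel" "c \<in> borel"
  shows "b \<otimes> c \<in> borel"
proof -
  obtain z y x where b: "b = ZK z \<otimes> RK y \<otimes> E x" and [simp]: "z \<noteq> 0" "y \<noteq> 0"
    using assms(1) by (auto simp: borel_def)
  obtain z' y' x' where c: "c = ZK z' \<otimes> RK y' \<otimes> E x'" and [simp]: "z' \<noteq> 0" "y' \<noteq> 0"
    using assms(2) by (auto simp: borel_def)
  have "b \<otimes> c = ZK z \<otimes> (RK y \<otimes> E x \<otimes> ZK z') \<otimes> RK y' \<otimes> E x'"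
    by (simp add: b c m_assoc)
  also have "RK y \<otimes> E x \<otimes> ZK z' = ZK z' \<otimes> (RK y \<otimes> E x)"
    by (simp add: commute_mult central_RK central_E central_ZK)
  also have "ZK z \<otimes> \<dots> \<otimes> RK y' \<otimes> E x' = ZK (z * z') \<otimes> RK y \<otimes> (E x \<otimes> RK y') \<otimes> E x'"
    by (simp add: ZK_mult[symmetric] m_assoc)
  also have "E x \<otimes> RK y' = RK y' \<otimes> E (x / y')"
    by (simp add: RK_E)
  also have "ZK (z * z') \<otimes> RK y \<otimes> \<dots> \<otimes> E x' = ZK (z * z') \<otimes> RK (y * y') \<otimes> E (x / y' + x')"
    by (simp add: RK_mult[symmetric] E_add[symmetric] m_assoc)
  finally show ?thesis by (simp add: borelI)
qed

lemma S_borel: "S \<in> borel"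
proof -
  have "E 1 \<otimes> RK (-1) = S"
    using RK_mult[of "-1" "-1"] by (simp add: E_def m_assoc)
  then show ?thesis using borel_mult[OF E_borel RK_borel, of "-1" 1] by simp
qed

lemma borel_big_cell:
  assumes "b \<in> borel" "m \<in> big_cell"
  shows "b \<otimes> m \<in> big_cell"
proof -
  obtain c x where m: "m = c \<otimes> J \<otimes> E x" "c \<in> borel" using assms(2) by (auto simp: big_cell_def)
  have "b \<otimes> m = (b \<otimes> c) \<otimes> J \<otimes> E x"
    using assms(1) m by (simp add: borel_closed m_assoc)
  then show ?thesis using assms(1) m borel_mult by (auto simp: big_cell_def)
qed

lemma J_borel:
  assumes "b \<in> borel"
  shows "J \<otimes> b \<in> big_cell"
proof -
  obtain z y x where b: "b = ZK z \<otimes> RK y \<otimes> E x" and [simp]: "z \<noteq> 0" "y \<noteq> 0"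
    using assms by (auto simp: borel_def)
  have "J \<otimes> b = (J \<otimes> ZK z) \<otimes> RK y \<otimes> E x"
    by (simp add: b m_assoc)
  also have "\<dots> = ZK z \<otimes> (J \<otimes> RK y) \<otimes> E x"
    by (simp add: central_J[OF central_ZK, symmetric] m_assoc)
  also have "\<dots> = (ZK z \<otimes> (ZK y \<otimes> RK (inverse y))) \<otimes> J \<otimes> E x"
    by (simp add: J_RK m_assoc)
  finally show ?thesis
    using borel_mult ZK_borel RK_borel by (auto simp: big_cell_def)
qed

text \<open>Both copies of \<open>J\<close> are moved through the diagonal factors of
  \<open>E x\<close> to reach \<open>S\<close>; the resulting \<open>J S J\<close> becomes
  \<open>S J S\<close> by the braid relation. Thus a product with two \<open>J\<close> has only one
  left.\<close>

lemma J_E_J: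
  assumes "x \<noteq> 0"
  shows "J \<otimes> E x \<otimes> J = ZK x \<otimes> ZK (- inverse x) \<otimes> RK (inverse x) \<otimes> S \<otimes> J \<otimes> (S \<otimes> RK (- x))"
proof -
  let ?z = "ZK (- inverse x)"
  have "RK (- inverse x) \<otimes> J = J \<otimes> (J \<otimes> RK (- inverse x)) \<otimes> J"
    using assms by (simp add: m_assoc[symmetric] JJ)
  also have "\<dots> = J \<otimes> (?z \<otimes> RK (- x))"
    using assms by (simp add: J_RK m_assoc JJ)
  finally have *: "RK (- inverse x) \<otimes> J = J \<otimes> (?z \<otimes> RK (- x))" .
  have "J \<otimes> E x \<otimes> J = (J \<otimes> RK x) \<otimes> S \<otimes> (RK (- inverse x) \<otimes> J)"
    using assms by (simp add: E_def m_assoc)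
  also have "\<dots> = ZK x \<otimes> RK (inverse x) \<otimes> (J \<otimes> S \<otimes> J \<otimes> ?z) \<otimes> RK (- x)"
    unfolding * J_RK[OF assms] using assms by (simp add: m_assoc)
  also have "J \<otimes> S \<otimes> J \<otimes> ?z = ?z \<otimes> (J \<otimes> S \<otimes> J)"
    using assms by (simp add: commute_mult central_J central_S central_ZK)
  also have "ZK x \<otimes> RK (inverse x) \<otimes> \<dots> \<otimes> RK (- x) =
      ZK x \<otimes> (RK (inverse x) \<otimes> ?z) \<otimes> (J \<otimes> S \<otimes> J) \<otimes> RK (- x)"
    using assms by (simp add: m_assoc)
  also have "\<dots> = ZK x \<otimes> (?z \<otimes> RK (inverse x)) \<otimes> (S \<otimes> J \<otimes> S) \<otimes> RK (- x)"
    using assms by (simp add: central_RK central_ZK JSJ)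
  finally show ?thesis using assms by (simp add: m_assoc)
qed

text \<open>After \<open>J b\<close> is rewritten as \<open>c J E y\<close>, the product contains
  \<open>J E y J\<close>: for \<open>y = 0\<close> the two \<open>J\<close> cancel, otherwise
  \<open>J_E_J\<close> leaves a single \<open>J\<close> between elements of
  \<open>borel\<close>.\<close>

lemma J_big_cell:
  assumes "m \<in> big_cell"
  shows "J \<otimes> m \<in> borel \<union> big_cell"
proof -
  obtain b x where m: "m = b \<otimes> J \<otimes> E x" and b: "b \<in> borel"
    using assms by (auto simp: big_cell_def)
  obtain c y where c: "J \<otimes> b = c \<otimes> J \<otimes> E y" "c \<in> borel"
    using J_borel[OF b] by (auto simp: big_cell_def)
  have "J \<otimes> m = (J \<otimes> b) \<otimes> J \<otimes> E x"
    using b by (simp add: m borel_closed m_assoc)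
  then have eq: "J \<otimes> m = c \<otimes> (J \<otimes> E y \<otimes> J \<otimes> E x)"
    using c by (simp add: borel_closed m_assoc)
  show ?thesis
  proof (cases "y = 0")
    case True
    then show ?thesis using eq c(2) by (simp add: JJ borel_mult E_borel)
  next
    case False
    let ?d = "ZK y \<otimes> ZK (- inverse y) \<otimes> RK (inverse y) \<otimes> S"
    have "?d \<in> borel" "S \<otimes> RK (- y) \<otimes> E x \<in> borel"
      using False by (simp_all add: borel_mult ZK_borel RK_borel S_borel E_borel)
    then have "?d \<otimes> (J \<otimes> (S \<otimes> RK (- y) \<otimes> E x)) \<in> big_cell"
      by (intro borel_big_cell J_borel)
    moreover have "J \<otimes> E y \<otimes> J \<otimes> E x = ?d \<otimes> (J \<otimes> (S \<otimes> RK (- y) \<otimes> E x))"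
      unfolding J_E_J[OF False] using False by (simp add: m_assoc)
    ultimately show ?thesis using eq c(2) borel_big_cell by simp
  qed
qed

lemma J_mult: "m \<in> borel \<union> big_cell \<Longrightarrow> J \<otimes> m \<in> borel \<union> big_cell"
  using J_borel J_big_cell by blast

lemma borel_mult_left: "b \<in> borel \<Longrightarrow> m \<in> borel \<union> big_cell \<Longrightarrow> b \<otimes> m \<in> borel \<union> big_cell"
  using borel_mult borel_big_cell by blast

lemma cells_closed: "m \<in> borel \<union> big_cell \<Longrightarrow> m \<in> carrier G"
  by (auto simp: big_cell_def borel_closed)

text \<open>The inductive step for words. Each \<open>T \<alpha>\<close> is \<open>J\<close> times a
  diagonal element, so stability under \<open>J\<close> and \<open>borel\<close> suffices.\<close>

lemma gen_mult:
  assumes x: "x \<in> generators v" and m: "m \<in> borel \<union> big_cell"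
  shows "g x \<otimes> m \<in> borel \<union> big_cell" "inv (g x) \<otimes> m \<in> borel \<union> big_cell"
proof -
  note mc = cells_closed[OF m]
  consider (R) a where "unit a" "g x = R a" | (S) "g x = S" | (J) "g x = J" | (T) \<alpha> where "pos \<alpha>" "g x = T \<alpha>"
    using x by (auto simp: generators_def Units_iff R_elt_def S_elt_def J_elt_def T_elt_def pos_def simp del: posD)
      (metis)
  then have "g x \<otimes> m \<in> borel \<union> big_cell \<and> inv (g x) \<otimes> m \<in> borel \<union> big_cell"
  proof cases
    case R
    have "R a \<in> borel" "R (inverse a) \<in> borel"
      using RK_borel[of a] RK_borel[of "inverse a"] RK_unit[of a] RK_unit[of "inverse a"] R unit_nonzero
      by auto
    then show ?thesis using R m by (simp only: inv_R borel_mult_left)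
  next
    case S
    have "inv S = S" using SS by (intro inv_equality) simp_all
    then show ?thesis using S m by (simp only: borel_mult_left S_borel)
  next
    case J
    have "inv J = J" using JJ by (intro inv_equality) simp_all
    then show ?thesis using J m by (simp only: J_mult)
  next
    case T
    have eq: "T \<alpha> = J \<otimes> RK (t \<alpha>)" using T by (simp add: RK_t D_def)
    have inv: "inv T \<alpha> = RK (inverse (t \<alpha>)) \<otimes> J"
      using T by (intro inv_equality) (simp_all add: eq RK_mult m_assoc)
    have "RK (t \<alpha>) \<in> borel" "RK (inverse (t \<alpha>)) \<in> borel" using T by (simp_all add: RK_borel)
    moreover have "T \<alpha> \<otimes> m = J \<otimes> (RK (t \<alpha>) \<otimes> m)"
      "inv T \<alpha> \<otimes> m = RK (inverse (t \<alpha>)) \<otimes> (J \<otimes> m)"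
      using T mc inv by (simp_all add: eq m_assoc)
    ultimately show ?thesis using T(2) m by (simp only: J_mult borel_mult_left)
  qed
  then show "g x \<otimes> m \<in> borel \<union> big_cell" "inv (g x) \<otimes> m \<in> borel \<union> big_cell" by auto
qed

end

section \<open>The matrix group\<close>

lemma mat2_nth [simp]:
  "mat2 a b c d $ 1 $ 1 = a" "mat2 a b c d $ 1 $ 2 = b"
  "mat2 a b c d $ 2 $ 1 = c" "mat2 a b c d $ 2 $ 2 = d"
  by (simp_all add: mat2_def)

lemma mat2_eq_iff [simp]:
  "mat2 a b c d = mat2 a' b' c' d' \<longleftrightarrow> a = a' \<and> b = b' \<and> c = c' \<and> d = d'"
  by (auto simp: vec_eq_iff forall_2)

lemma mat2_mult [simp]:
  "mat2 a b c d ** mat2 a' b' c' d' =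
    mat2 (a * a' + b * c') (a * b' + b * d') (c * a' + d * c') (c * b' + d * d')"
  by (simp add: vec_eq_iff forall_2 matrix_matrix_mult_def sum_2)

lemma mat_1_eq_mat2: "mat 1 = mat2 1 0 0 1"
  by (simp add: vec_eq_iff forall_2 mat_def)

lemma mat2_cases: obtains a b c d where "A = mat2 a b c d"
proof
  show "A = mat2 (A $ 1 $ 1) (A $ 1 $ 2) (A $ 2 $ 1) (A $ 2 $ 2)"
    by (simp add: vec_eq_iff forall_2)
qed

lemma invertible_mat2_iff: "invertible (mat2 a b c d) \<longleftrightarrow> a * d - b * c \<noteq> 0"
proof
  assume "invertible (mat2 a b c d)"
  then obtain B where B: "mat2 a b c d ** B = mat 1" by (auto simp: invertible_def)
  obtain a' b' c' d' where "B = mat2 a' b' c' d'" by (rule mat2_cases)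
  with B have "a * a' + b * c' = 1" "a * b' + b * d' = 0" "c * a' + d * c' = 0" "c * b' + d * d' = 1"
    by (simp_all add: mat_1_eq_mat2)
  moreover have "(a * d - b * c) * (a' * d' - b' * c') =
      (a * a' + b * c') * (c * b' + d * d') - (a * b' + b * d') * (c * a' + d * c')"
    by (simp add: algebra_simps)
  ultimately have "(a * d - b * c) * (a' * d' - b' * c') = 1" by simp
  then show "a * d - b * c \<noteq> 0" by auto
next
  assume nz: "a * d - b * c \<noteq> 0"
  define e where "e = inverse (a * d - b * c)"
  have e: "(a * d - b * c) * e = 1" using nz by (simp add: e_def)
  \<comment> \<open>The adjugate divided by the determinant.\<close>
  let ?B = "mat2 (d * e) (- b * e) (- c * e) (a * e)"
  have "mat2 a b c d ** ?B = mat 1" "?B ** mat2 a b c d = mat 1"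
    unfolding mat2_mult mat_1_eq_mat2 mat2_eq_iff using e by (simp_all add: algebra_simps)
  then show "invertible (mat2 a b c d)" unfolding invertible_def by blast
qed

lemma GL2_simps [simp]:
  "x \<otimes>\<^bsub>GL2\<^esub> y = x ** y" "\<one>\<^bsub>GL2\<^esub> = mat2 1 0 0 1"
  "mat2 a b c d \<in> carrier GL2 \<longleftrightarrow> a * d - b * c \<noteq> 0"
  by (simp_all add: GL2_def mat_1_eq_mat2 invertible_mat2_iff)

lemma group_GL2: "group GL2"
proof (rule groupI)
  fix A :: "'k::field ^ 2 ^ 2"
  assume "A \<in> carrier GL2"
  then obtain B where "A ** B = mat 1" "B ** A = mat 1" by (auto simp: GL2_def invertible_def)
  then show "\<exists>B\<in>carrier GL2. B \<otimes>\<^bsub>GL2\<^esub> A = \<one>\<^bsub>GL2\<^esub>"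
    by (intro bexI[of _ B]) (auto simp: GL2_def invertible_def)
next
  show "\<one>\<^bsub>GL2\<^esub> \<in> carrier GL2" by simp
qed (auto simp: GL2_def invertible_mult matrix_mul_assoc)

lemma square_GL2: "A \<in> carrier GL2 \<Longrightarrow> A [^]\<^bsub>GL2\<^esub> (2::nat) = A ** A"
  by (simp add: monoid.square_eq[OF group.is_monoid[OF group_GL2]])

lemma inv_GL2:
  assumes "a \<noteq> 0"
  shows "inv\<^bsub>GL2\<^esub> (mat2 a 0 0 1) = mat2 (inverse a) 0 0 1"
  using assms by (intro group.inv_equality[OF group_GL2]) simp_all

lemma R_elt_GL2: "R_elt GL2 (gen_matrix t) a = mat2 a 0 0 1"
  by (simp add: R_elt_def)

lemma Z_elt_GL2: "a \<noteq> 0 \<Longrightarrow> Z_elt GL2 (gen_matrix t) a = mat2 a 0 0 a"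
  by (simp add: Z_elt_def J_elt_def R_elt_GL2 square_GL2)

lemma Zt_elt_GL2: "t \<alpha> \<noteq> 0 \<Longrightarrow> Zt_elt GL2 (gen_matrix t) \<alpha> = mat2 (t \<alpha>) 0 0 (t \<alpha>)"
  by (simp add: Zt_elt_def T_elt_def square_GL2)

lemma commutator_GL2:
  "a \<noteq> 0 \<Longrightarrow> group_commutator GL2 (mat2 (-1) 1 0 1) (mat2 a 0 0 1) = mat2 1 (1 - a) 0 1"
  by (subst group.commutator_eq_iff[OF group_GL2]) simp_all

lemma S\<alpha>_elt_GL2: "t \<alpha> \<noteq> 1 \<Longrightarrow> S\<alpha>_elt GL2 (gen_matrix t) t \<alpha> = mat2 (-1) (t \<alpha>) 0 1"
  by (simp add: S\<alpha>_elt_def S_elt_def R_elt_GL2 commutator_GL2)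

lemma J\<alpha>_elt_GL2: "t \<alpha> \<noteq> 1 \<Longrightarrow> J\<alpha>_elt GL2 (gen_matrix t) t \<alpha> = mat2 1 0 (t \<alpha>) (-1)"
  by (simp add: J\<alpha>_elt_def J_elt_def S\<alpha>_elt_GL2)

section \<open>The relations for matrices and along homomorphisms\<close>

context valued_field begin

lemma gen_matrix_closed: "x \<in> generators v \<Longrightarrow> gen_matrix t x \<in> carrier GL2"
  by (auto simp: generators_def Units_iff unit_nonzero)

lemma GL2_relations_GL2:
  assumes "residue_representatives v \<kk>"
  shows "\<forall>p\<in>GL2_relations GL2 (gen_matrix t) t v \<kk>. fst p = snd p"
proof -
  interpret GL: group "GL2 :: ('k ^ 2 ^ 2) monoid" by (rule group_GL2)
  \<comment> \<open>These keep \<open>1 - t \<alpha>\<close> and \<open>1 - a * t \<alpha>\<close>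
    nonzero, as the formulas for commutators of matrices require.\<close>
  have t1: "pos \<alpha> \<Longrightarrow> t \<alpha> \<noteq> 1" "pos \<alpha> \<Longrightarrow> unit a \<Longrightarrow> a * t \<alpha> \<noteq> 1" for \<alpha> a
    using unit_one_minus_t(1)[of \<alpha>] unit_one_minus_t(2)[of \<alpha> a] by (auto simp: unit_def)
  have t0: "pos \<alpha> \<Longrightarrow> pos \<beta> \<Longrightarrow> t (\<alpha> + \<beta>) \<noteq> 0" for \<alpha> \<beta>
    by simp
  show ?thesis
    unfolding ball_GL2_relations fst_conv snd_conv
    using assms
    by (intro conjI allI impI; (elim conjE)?;
      simp add: R_elt_GL2 S_elt_def J_elt_def T_elt_def Z_elt_GL2 Zt_elt_GL2 S\<alpha>_elt_GL2 J\<alpha>_elt_GL2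
        commutator_GL2 inv_GL2 unit_nonzero GL.square_eq numeral_3_eq_3 GL.commutator_eq_iff
        GL.conj_eq_iff t1 t0 representatives_units field_simps)
qed

text \<open>The words in the relations are built from group operations, so a homomorphism carries
  those over \<open>F\<close> to those over \<open>H\<close>. It is applied to the identity of the
  free group, to homomorphisms into \<open>GL2\<close>, and to the projection onto the presented
  group.\<close>

lemma hom_GL2_relations:
  assumes "group_hom F H h" and g: "\<And>x. x \<in> generators v \<Longrightarrow> g x \<in> carrier F"
    and g': "\<And>x. x \<in> generators v \<Longrightarrow> h (g x) = g' x"
    and "residue_representatives v \<kk>"
  shows "\<forall>p\<in>GL2_relations F g t v \<kk>. fst p \<in> carrier F \<and> snd p \<in> carrier F"
    and "(\<forall>p\<in>GL2_relations F g t v \<kk>. h (fst p) = h (snd p)) \<longleftrightarrow>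
      (\<forall>p\<in>GL2_relations H g' t v \<kk>. fst p = snd p)"
proof -
  interpret group_hom F H h by fact
  note kk = representatives_units[OF assms(4)]
  have R: "unit a \<Longrightarrow> R_elt F g a \<in> carrier F \<and> h (R_elt F g a) = R_elt H g' a" for a
    using g[of "Gen_R a"] g'[of "Gen_R a"] by (auto simp: R_elt_def generators_def Units_iff)
  have S: "S_elt g \<in> carrier F \<and> h (S_elt g) = S_elt g'"
    using g[of "Gen_S"] g'[of "Gen_S"] by (auto simp: S_elt_def generators_def)
  have J: "J_elt g \<in> carrier F \<and> h (J_elt g) = J_elt g'"
    using g[of "Gen_J"] g'[of "Gen_J"] by (auto simp: J_elt_def generators_def)
  have T: "pos \<alpha> \<Longrightarrow> T_elt g \<alpha> \<in> carrier F \<and> h (T_elt g \<alpha>) = T_elt g' \<alpha>" for \<alpha>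
    using g[of "Gen_T \<alpha>"] g'[of "Gen_T \<alpha>"] by (auto simp: T_elt_def generators_def)
  have Z: "unit a \<Longrightarrow> Z_elt F g a \<in> carrier F \<and> h (Z_elt F g a) = Z_elt H g' a" for a
    using J R[of a] by (simp add: Z_elt_def hom_nat_pow)
  have Zt: "pos \<alpha> \<Longrightarrow> Zt_elt F g \<alpha> \<in> carrier F \<and> h (Zt_elt F g \<alpha>) = Zt_elt H g' \<alpha>" for \<alpha>
    using T[of \<alpha>] by (simp add: Zt_elt_def hom_nat_pow)
  have comm: "x \<in> carrier F \<Longrightarrow> y \<in> carrier F \<Longrightarrow> group_commutator F x y \<in> carrier F \<and>
    h (group_commutator F x y) = group_commutator H (h x) (h y)" for x y
    by (simp add: group_commutator_def)
  have conj: "x \<in> carrier F \<Longrightarrow> y \<in> carrier F \<Longrightarrow> group_conj F x y \<in> carrier F \<and>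
    h (group_conj F x y) = group_conj H (h x) (h y)" for x y
    by (simp add: group_conj_def)
  have S\<alpha>: "pos \<alpha> \<Longrightarrow> S\<alpha>_elt F g t \<alpha> \<in> carrier F \<and> h (S\<alpha>_elt F g t \<alpha>) = S\<alpha>_elt H g' t \<alpha>" for \<alpha>
    by (simp add: S\<alpha>_elt_def R S comm)
  have J\<alpha>: "pos \<alpha> \<Longrightarrow> J\<alpha>_elt F g t \<alpha> \<in> carrier F \<and> h (J\<alpha>_elt F g t \<alpha>) = J\<alpha>_elt H g' t \<alpha>" for \<alpha>
    by (simp add: J\<alpha>_elt_def J S\<alpha>)
  have kk': "a \<in> \<kk> \<Longrightarrow> unit (a / (a - 1))" for a
  proof -
    assume "a \<in> \<kk>"
    then have "unit (- (a / (1 - a)))" using kk[of a] by simp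
    then show "unit (a / (a - 1))" by (metis minus_diff_eq minus_divide_right)
  qed
  show "\<forall>p\<in>GL2_relations F g t v \<kk>. fst p \<in> carrier F \<and> snd p \<in> carrier F"
    unfolding ball_GL2_relations fst_conv snd_conv
    by (intro conjI allI impI; (elim conjE)?;
      simp add: R S J T Z Zt comm conj S\<alpha> J\<alpha> kk kk' unit_u pos_add)
  show "(\<forall>p\<in>GL2_relations F g t v \<kk>. h (fst p) = h (snd p)) \<longleftrightarrow>
      (\<forall>p\<in>GL2_relations H g' t v \<kk>. fst p = snd p)"
    unfolding ball_GL2_relations fst_conv snd_conv
    by (intro arg_cong2[of _ _ _ _ "(\<and>)"] all_cong1 imp_cong refl; (elim conjE)?;
      simp add: R S J T Z Zt comm conj S\<alpha> J\<alpha> kk kk' unit_u pos_add hom_nat_pow)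
qed

end

section \<open>Normal forms and their matrices\<close>

context GL2_relators begin

context
  fixes \<phi> :: "'a \<Rightarrow> 'k ^ 2 ^ 2"
  assumes \<phi>: "\<phi> \<in> hom G GL2"
    and \<phi>_gen: "\<And>x. x \<in> generators v \<Longrightarrow> \<phi> (g x) = gen_matrix t x"
begin

interpretation \<phi>: group_hom G GL2 \<phi>
  by (intro group_hom.intro group_hom_axioms.intro is_group group_GL2 \<phi>)

lemma \<phi>_R: "unit a \<Longrightarrow> \<phi> (R a) = mat2 a 0 0 1"
  and \<phi>_S: "\<phi> S = mat2 (-1) 1 0 1"
  and \<phi>_J: "\<phi> J = mat2 0 (-1) (-1) 0"
  and \<phi>_T: "pos \<alpha> \<Longrightarrow> \<phi> (T \<alpha>) = mat2 0 (-1) (- t \<alpha>) 0"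
  using \<phi>.hom_one
  by (auto simp: R_elt_def S_elt_def J_elt_def T_elt_def generators_def Units_iff \<phi>_gen)

lemma \<phi>_RO: "integral x \<Longrightarrow> \<phi> (RO x) = mat2 x 0 0 1"
  using \<phi>.hom_one by (auto simp: RO_def D_def pos_def \<phi>_R \<phi>_J \<phi>_T simp del: posD)

lemma \<phi>_RK:
  assumes "x \<noteq> 0"
  shows "\<phi> (RK x) = mat2 x 0 0 1"
  using assms
proof (cases rule: integral_cases)
  case 2
  then have "\<phi> (RK x) = inv\<^bsub>GL2\<^esub> \<phi> (RO (inverse x))" by simp
  then show ?thesis using 2(1) assms by (simp add: \<phi>_RO inv_GL2)
qed (simp add: \<phi>_RO)

lemma \<phi>_ZK: "z \<noteq> 0 \<Longrightarrow> \<phi> (ZK z) = mat2 z 0 0 z"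
  by (simp add: ZK_def \<phi>_RK \<phi>_J)

lemma \<phi>_E: "\<phi> (E x) = mat2 1 x 0 1"
  using \<phi>.hom_one by (simp add: E_def \<phi>_RK \<phi>_S)

lemma \<phi>_borel:
  "z \<noteq> 0 \<Longrightarrow> y \<noteq> 0 \<Longrightarrow> \<phi> (ZK z \<otimes> RK y \<otimes> E x) = mat2 (z * y) (z * y * x) 0 z"
  by (simp add: \<phi>_ZK \<phi>_RK \<phi>_E)

lemma \<phi>_big_cell:
  "z \<noteq> 0 \<Longrightarrow> y \<noteq> 0 \<Longrightarrow> \<phi> (ZK z \<otimes> RK y \<otimes> E x \<otimes> J \<otimes> E x') =
    mat2 (- (z * y * x)) (- (z * y * x * x') - z * y) (- z) (- (z * x'))"
  by (simp add: \<phi>_ZK \<phi>_RK \<phi>_E \<phi>_J)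

text \<open>A big-cell matrix has nonzero lower left entry and is never the identity, while an upper
  triangular one determines its parameters; this gives a trivial kernel. Conversely, every
  invertible matrix is matched by solving for the parameters.\<close>

lemma bij_betw_GL2:
  assumes cells: "carrier G \<subseteq> borel \<union> big_cell"
  shows "bij_betw \<phi> (carrier G) (carrier GL2)"
proof -
  have "x = \<one>" if x: "x \<in> carrier G" "\<phi> x = \<one>\<^bsub>GL2\<^esub>" for x
  proof -
    have "x \<in> borel \<or> x \<in> big_cell" using x(1) cells by blast
    then show ?thesis
    proof
      assume "x \<in> borel"
      then obtain z y w where "z \<noteq> 0" "y \<noteq> 0" "x = ZK z \<otimes> RK y \<otimes> E w" by (auto simp: borel_def)
      moreover from this have "z = 1" "y = 1" "w = 0"
        using x(2) \<phi>_borel[of z y w] by auto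
      ultimately show ?thesis by simp
    next
      assume "x \<in> big_cell"
      then obtain z y w w' where "z \<noteq> 0" "y \<noteq> 0" "x = ZK z \<otimes> RK y \<otimes> E w \<otimes> J \<otimes> E w'"
        by (auto simp: big_cell_def borel_def)
      then show ?thesis using x(2) \<phi>_big_cell[of z y w w'] by simp
    qed
  qed
  then have "inj_on \<phi> (carrier G)"
    by (intro \<phi>.trivial_ker_imp_inj) (auto simp: kernel_def)
  moreover have "A \<in> \<phi> ` carrier G" if A: "A \<in> carrier GL2" for A
  proof -
    obtain a b c d where A_eq: "A = mat2 a b c d" by (rule mat2_cases)
    have det: "a * d - b * c \<noteq> 0" using A by (simp add: A_eq)
    show ?thesis
    proof (cases "c = 0")
      case True
      then have nz: "a \<noteq> 0" "d \<noteq> 0" using det by auto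
      \<comment> \<open>The parameters come from solving \<open>\<phi>_borel\<close> for the
        entries; \<open>d\<close> is the scalar.\<close>
      let ?w = "ZK d \<otimes> RK (a / d) \<otimes> E (b / a)"
      have "\<phi> ?w = mat2 (d * (a / d)) (d * (a / d) * (b / a)) 0 d"
        using nz by (intro \<phi>_borel) simp_all
      also have "\<dots> = A" using nz True by (simp add: A_eq)
      finally have "\<phi> ?w = A" .
      moreover have "\<phi> ?w \<in> \<phi> ` carrier G"
        using nz by (intro imageI) simp
      ultimately show ?thesis by (simp only:)
    next
      case False
      \<comment> \<open>Solves \<open>\<phi>_big_cell\<close> for the upper right entry once the
        bottom row has fixed \<open>z = - c\<close> and \<open>x' = d / c\<close>; \<open>y\<close>
        is minus the determinant divided by the square of \<open>c\<close>.\<close>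
      define y where "y = (b * c - a * d) / c\<^sup>2"
      have y: "y \<noteq> 0" using det False by (auto simp: y_def)
      let ?w = "ZK (- c) \<otimes> RK y \<otimes> E (a / (c * y)) \<otimes> J \<otimes> E (d / c)"
      have "\<phi> ?w = mat2 a (a * (d / c) + c * y) c d"
        using False y \<phi>_big_cell[of "- c" y "a / (c * y)" "d / c"] by simp
      also have "a * (d / c) + c * y = b"
        using False by (simp add: y_def field_simps power2_eq_square)
      finally have "\<phi> ?w = A" by (simp only: A_eq)
      moreover have "\<phi> ?w \<in> \<phi> ` carrier G"
        using False y by (intro imageI) simp
      ultimately show ?thesis by (simp only:)
    qed
  qed
  ultimately show ?thesis
    using \<phi>.hom_closed by (auto simp: bij_betw_def)
qed

end

end

section \<open>Identification of the presented group with the matrix group\<close>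

theorem theorem4p6:
  fixes v :: "'k::field \<Rightarrow> 'g::linordered_ab_group_add"
    and t :: "'g \<Rightarrow> 'k"
    and \<kk> :: "'k set"
  assumes "nontrivial_valuation v"
    and "value_section v t"
    and "residue_representatives v \<kk>"
  shows "has_presentation (GL2 :: ('k ^ 2 ^ 2) monoid) (generators v) (gen_matrix t)
           (GL2_relations (free_group (generators v)) free_gen t v \<kk>)"
proof -
  interpret valued_field v t using assms by unfold_locales
  let ?X = "generators v"
  let ?F = "free_group ?X"
  let ?Rel = "GL2_relations ?F free_gen t v \<kk>"
  let ?N = "relation_subgroup ?X ?Rel"
  let ?\<Gamma> = "presented_group ?X ?Rel"
  let ?\<pi> = "\<lambda>w. ?N #>\<^bsub>?F\<^esub> w"
  interpret F: group ?F by (rule group_free_group)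
  \<comment> \<open>Transport along the identity shows that both sides of every relation lie in the
    free group.\<close>
  have F_id: "group_hom ?F ?F (\<lambda>w. w)"
    by unfold_locales (simp add: hom_def)
  show ?thesis
  proof (rule has_presentationI)
    show "group (GL2 :: ('k ^ 2 ^ 2) monoid)" by (rule group_GL2)
    show "gen_matrix t ` ?X \<subseteq> carrier GL2" using gen_matrix_closed by blast
    show "l \<in> carrier ?F \<and> r \<in> carrier ?F" if "(l, r) \<in> ?Rel" for l r
      using hom_GL2_relations(1)[OF F_id _ _ assms(3), of free_gen] free_gen_closed that by fastforce
    show "h l = h r" if h: "h \<in> hom ?F GL2" "\<And>x. x \<in> ?X \<Longrightarrow> h (free_gen x) = gen_matrix t x"
      and lr: "(l, r) \<in> ?Rel" for h l r
    proof -
      have "group_hom ?F GL2 h"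
        using h(1) group_GL2 by (simp add: group_hom_def group_hom_axioms_def F.is_group)
      then have "(\<forall>p\<in>?Rel. h (fst p) = h (snd p)) \<longleftrightarrow>
          (\<forall>p\<in>GL2_relations GL2 (gen_matrix t) t v \<kk>. fst p = snd p)"
        by (rule hom_GL2_relations(2)) (simp_all add: h(2) free_gen_closed assms(3))
      then have "\<forall>p\<in>?Rel. h (fst p) = h (snd p)"
        using GL2_relations_GL2[OF assms(3)] by simp
      from bspec[OF this lr] show ?thesis by simp
    qed
    show "bij_betw \<phi> (carrier ?\<Gamma>) (carrier GL2)"
      if \<Gamma>: "group ?\<Gamma>" and \<pi>: "?\<pi> \<in> hom ?F ?\<Gamma>"
        and rel: "\<And>l r. (l, r) \<in> ?Rel \<Longrightarrow> ?\<pi> l = ?\<pi> r"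
        and \<phi>: "\<phi> \<in> hom ?\<Gamma> GL2" "\<And>x. x \<in> ?X \<Longrightarrow> \<phi> (?\<pi> (free_gen x)) = gen_matrix t x" for \<phi>
    proof -
      interpret \<pi>: group_hom ?F ?\<Gamma> ?\<pi>
        using \<Gamma> \<pi> by (simp add: group_hom_def group_hom_axioms_def F.is_group)
      \<comment> \<open>The relations are written with words of the free group; transport along the
        projection turns them into relations between the images of the generators, as the locale
        expects.\<close>
      have "(\<forall>p\<in>?Rel. ?\<pi> (fst p) = ?\<pi> (snd p)) \<longleftrightarrow>
          (\<forall>p\<in>GL2_relations ?\<Gamma> (\<lambda>x. ?\<pi> (free_gen x)) t v \<kk>. fst p = snd p)"
        using \<pi>.group_hom_axioms
        by (rule hom_GL2_relations(2)) (simp_all add: free_gen_closed assms(3))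
      moreover have "\<forall>p\<in>?Rel. ?\<pi> (fst p) = ?\<pi> (snd p)"
        using rel by fastforce
      ultimately have rel\<Gamma>: "\<forall>p\<in>GL2_relations ?\<Gamma> (\<lambda>x. ?\<pi> (free_gen x)) t v \<kk>. fst p = snd p"
        by (simp only:)
      interpret GL2_relators v t ?\<Gamma> "\<lambda>x. ?\<pi> (free_gen x)" \<kk>
      proof unfold_locales
        show "?\<pi> (free_gen x) \<in> carrier ?\<Gamma>" if "x \<in> ?X" for x
          by (rule \<pi>.hom_closed[OF free_gen_closed[OF that]])
        show "l = r" if "(l, r) \<in> GL2_relations ?\<Gamma> (\<lambda>x. ?\<pi> (free_gen x)) t v \<kk>" for l r
          using bspec[OF rel\<Gamma> that] by simp
      qed
      \<comment> \<open>The empty word lies in \<open>borel\<close> as \<open>E 0\<close>, and each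
        further letter preserves the union of the cells; since every coset is some
        \<open>?\<pi> w\<close>, the cells cover the presented group.\<close>
      have "?\<pi> w \<in> borel \<union> big_cell" if "w \<in> carrier ?F" for w
        using that
      proof (induction rule: free_group_induct)
        case one
        then show ?case using E_borel[of 0] by simp
      next
        case (gen x w)
        then show ?case using gen_mult(1)[of x "?\<pi> w"] free_gen_closed[of x ?X] by simp
      next
        case (inv_gen x w)
        then show ?case using gen_mult(2)[of x "?\<pi> w"] free_gen_closed[of x ?X] by simp
      qed
      then have "carrier ?\<Gamma> \<subseteq> borel \<union> big_cell"
        by (auto simp: presented_group_def FactGroup_def RCOSETS_def)
      then show ?thesis using \<phi> by (intro bij_betw_GL2) auto
    qed
  qed
qed

end
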